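(* Let $F=\dfrac{\beta^2}{\beta-\alpha}$ be a $G$-invariant infinite series metric on the reductive homogeneous Finsler space $G/H$ with a decomposition of the Lie algebra $\mathfrak g=\mathfrak h+\mathfrak m$. Then $(G/H,F)$ has isotropic $S$-curvature if and only if it has vanishing $S$-curvature.
   Context: A Finsler metric on a connected smooth $n$-manifold $M$ is a function $F:TM\to[0,\infty)$, smooth on $TM\setminus\{0\}$, whose restriction to each $T_xM$ is a Minkowski norm, i.e. $F$ is positively homogeneous of degree one in $y$ and the Hessian $g_{ij}=\frac12(F^2)_{y^iy^j}$ is positive definite for $y\neq0$. The infinite series $(\alpha,\beta)$-metric is the metric $F=\beta^2/(\beta-\alpha)=\alpha\phi(s)$, $s=\beta/\alpha$, $\phi(s)=s^2/(s-1)$, where $\alpha(x,y)=\sqrt{a_{ij}(x)y^iy^j}$ is (the norm of) a Riemannian metric and $\beta=b_i(x)y^i$ is a 1-form. $G$ is a Lie group and $H$ a compact (isotropy) subgroup, with Lie algebras $\mathfrak g,\mathfrak h$ and $G/H$ connected; reductive means $\mathfrak g=\mathfrak h\oplus\mathfrak m$ as vector spaces with $\mathrm{Ad}(h)\mathfrak m\subset\mathfrak m$ for all $h\in H$. $F$ is $G$-invariant if it is preserved by the natural action of $G$. $S$-curvature: for a basis of $T_xM$ let $\sigma_F(x)=\mathrm{Vol}(B^n)/\mathrm{Vol}\{(y^i)\in\mathbb R^n: F(x,y^ie_i)<1\}$ ($B^n$ the Euclidean unit ball), and let $\tau(x,y)=\ln\big(\sqrt{\det(g_{ij}(x,y))}/\sigma_F(x)\big)$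 be the distortion. Then $S(x,y)=\frac{d}{dt}\big[\tau(\gamma(t),\dot\gamma(t))\big]_{t=0}$, where $\gamma$ is the geodesic of $F$ with $\gamma(0)=x$, $\dot\gamma(0)=y\ne0$. An $n$-dimensional Finsler space $(M,F)$ has isotropic $S$-curvature if there is a smooth function $c(x)$ on $M$ with $S(x,y)=(n+1)c(x)F(x,y)$ for all $x\in M$, $y\in T_xM\setminus\{0\}$; it has vanishing $S$-curvature if $S\equiv0$.
   Formalization: Since β(−y) = −β(y), F = β²/(β−α) cannot be positive on all of TM∖0, so no such Finsler metric exists if dim G/H ≥ 1; F, its G-invariance, unit ball volume and S-curvature are taken on the cone α < β, assumed nonempty at each point. The one-point space is excluded. *)

theory Defs
  imports "HOL-Analysis.Analysis" "HOL-Algebra.Left_Coset"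
begin

section \<open>Smooth maps between open subsets of Euclidean spaces\<close>

text \<open>Only meant for open sets \<open>S\<close>; there \<open>Ck_on k S f\<close> is the usual class of k times
  continuously differentiable functions.\<close>

primrec Ck_on :: "nat \<Rightarrow> 'a::euclidean_space set \<Rightarrow> ('a \<Rightarrow> 'b::real_normed_vector) \<Rightarrow> bool" where
  "Ck_on 0 S f \<longleftrightarrow> continuous_on S f"
| "Ck_on (Suc k) S f \<longleftrightarrow> f differentiable_on S \<and>
     (\<forall>i\<in>Basis. Ck_on k S (\<lambda>x. frechet_derivative f (at x) i))"

definition smooth_on :: "'a::euclidean_space set \<Rightarrow> ('a \<Rightarrow> 'b::real_normed_vector) \<Rightarrow> bool" where
  "smooth_on S f \<longleftrightarrow> (\<forall>k. Ck_on k S f)"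


section \<open>Smooth manifolds given by an atlas\<close>

text \<open>A chart is a pair of its domain and its coordinate map; the values of the coordinate map
  outside the domain are irrelevant.\<close>

type_synonym ('p, 'e) chart = "'p set \<times> ('p \<Rightarrow> 'e)"

record ('p, 'e) mfd =
  mtop :: "'p topology"
  charts :: "('p, 'e) chart set"

definition chart_inv :: "('p, 'e) chart \<Rightarrow> 'e \<Rightarrow> 'p" where
  "chart_inv c = inv_into (fst c) (snd c)"

definition charts_at :: "('p, 'e) mfd \<Rightarrow> 'p \<Rightarrow> ('p, 'e) chart set" where
  "charts_at M p = {c \<in> charts M. p \<in> fst c}"

definition smooth_manifold :: "('p, 'e::euclidean_space) mfd \<Rightarrow> bool" where
  "smooth_manifold M \<longleftrightarrow>
     Hausdorff_space (mtop M) \<and> second_countable (mtop M) \<and>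
     (\<Union>c\<in>charts M. fst c) = topspace (mtop M) \<and>
     (\<forall>c\<in>charts M. openin (mtop M) (fst c) \<and> open (snd c ` fst c) \<and>
        homeomorphic_map (subtopology (mtop M) (fst c)) (top_of_set (snd c ` fst c)) (snd c)) \<and>
     (\<forall>c\<in>charts M. \<forall>c'\<in>charts M.
        smooth_on (snd c ` (fst c \<inter> fst c')) (snd c' \<circ> chart_inv c))"

definition smooth_map ::
  "('p, 'e::euclidean_space) mfd \<Rightarrow> ('q, 'f::euclidean_space) mfd \<Rightarrow> ('p \<Rightarrow> 'q) \<Rightarrow> bool" where
  "smooth_map M N f \<longleftrightarrow> continuous_map (mtop M) (mtop N) f \<and>
     (\<forall>c\<in>charts M. \<forall>c'\<in>charts N.
        smooth_on (snd c ` {p \<in> fst c. f p \<in> fst c'}) (snd c' \<circ> f \<circ> chart_inv c))"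

definition smooth_function :: "('p, 'e::euclidean_space) mfd \<Rightarrow> ('p \<Rightarrow> real) \<Rightarrow> bool" where
  "smooth_function M f \<longleftrightarrow> (\<forall>c\<in>charts M. smooth_on (snd c ` fst c) (f \<circ> chart_inv c))"

definition smooth_curve :: "('p, 'e::euclidean_space) mfd \<Rightarrow> real set \<Rightarrow> (real \<Rightarrow> 'p) \<Rightarrow> bool" where
  "smooth_curve M I \<gamma> \<longleftrightarrow> continuous_map (top_of_set I) (mtop M) \<gamma> \<and>
     (\<forall>c\<in>charts M. smooth_on {t \<in> I. \<gamma> t \<in> fst c} (snd c \<circ> \<gamma>))"

definition prod_mfd :: "('p, 'e) mfd \<Rightarrow> ('q, 'f) mfd \<Rightarrow> ('p \<times> 'q, 'e \<times> 'f) mfd" where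
  "prod_mfd M N = \<lparr> mtop = prod_topology (mtop M) (mtop N),
     charts = {(fst c \<times> fst d, map_prod (snd c) (snd d)) | c d. c \<in> charts M \<and> d \<in> charts N} \<rparr>"


section \<open>Tangent vectors\<close>

text \<open>A tangent vector at \<open>p\<close> is the family of its components in all charts around \<open>p\<close>, related by
  the Jacobians of the coordinate changes; the entries at all other charts are set to 0, so that
  the vector space operations are pointwise.\<close>

type_synonym ('p, 'e) tvec = "('p, 'e) chart \<Rightarrow> 'e"

definition tv_zero :: "('p, 'e::real_vector) tvec" where
  "tv_zero = (\<lambda>c. 0)"

definition tv_add :: "('p, 'e::real_vector) tvec \<Rightarrow> ('p, 'e) tvec \<Rightarrow> ('p, 'e) tvec" where
  "tv_add v w = (\<lambda>c. v c + w c)"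

definition tv_scale :: "real \<Rightarrow> ('p, 'e::real_vector) tvec \<Rightarrow> ('p, 'e) tvec" where
  "tv_scale r v = (\<lambda>c. r *\<^sub>R v c)"

definition tangent_space :: "('p, 'e::euclidean_space) mfd \<Rightarrow> 'p \<Rightarrow> ('p, 'e) tvec set" where
  "tangent_space M p = {v.
     (\<forall>c\<in>charts_at M p. \<forall>c'\<in>charts_at M p.
        v c' = frechet_derivative (snd c' \<circ> chart_inv c) (at (snd c p)) (v c)) \<and>
     (\<forall>c. c \<notin> charts_at M p \<longrightarrow> v c = 0)}"

text \<open>The tangent vector at \<open>p\<close> whose components in the chart \<open>c\<close> around \<open>p\<close> are \<open>w\<close>.\<close>

definition tvec_of ::
  "('p, 'e::euclidean_space) mfd \<Rightarrow> ('p, 'e) chart \<Rightarrow> 'p \<Rightarrow> 'e \<Rightarrow> ('p, 'e) tvec" where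
  "tvec_of M c p w = (\<lambda>c'. if c' \<in> charts_at M p
     then frechet_derivative (snd c' \<circ> chart_inv c) (at (snd c p)) w else 0)"

text \<open>The chart around \<open>p\<close> is arbitrary: by the chain rule the value does not depend on it.\<close>

definition differential ::
  "('p, 'e::euclidean_space) mfd \<Rightarrow> ('q, 'f::euclidean_space) mfd \<Rightarrow> ('p \<Rightarrow> 'q) \<Rightarrow> 'p \<Rightarrow>
   ('p, 'e) tvec \<Rightarrow> ('q, 'f) tvec" where
  "differential M N f p v = (\<lambda>c'. if c' \<in> charts_at N (f p)
     then (let c = (SOME c. c \<in> charts_at M p)
           in frechet_derivative (snd c' \<circ> f \<circ> chart_inv c) (at (snd c p)) (v c))
     else 0)"

definition velocity ::
  "('p, 'e::euclidean_space) mfd \<Rightarrow> (real \<Rightarrow> 'p) \<Rightarrow> real \<Rightarrow> ('p, 'e) tvec" where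
  "velocity M \<gamma> t = (\<lambda>c. if c \<in> charts_at M (\<gamma> t)
     then vector_derivative (snd c \<circ> \<gamma>) (at t) else 0)"

definition slit_tangent_bundle :: "('p, 'e::euclidean_space) mfd \<Rightarrow> ('p \<times> ('p, 'e) tvec) set" where
  "slit_tangent_bundle M =
     {(p, v). p \<in> topspace (mtop M) \<and> v \<in> tangent_space M p \<and> v \<noteq> tv_zero}"


section \<open>Lie groups and homogeneous spaces\<close>

definition lie_group :: "('g, 'x) monoid_scheme \<Rightarrow> ('g, 'f::euclidean_space) mfd \<Rightarrow> bool" where
  "lie_group G L \<longleftrightarrow> group G \<and> smooth_manifold L \<and> topspace (mtop L) = carrier G \<and>
     smooth_map (prod_mfd L L) L (\<lambda>(a, b). a \<otimes>\<^bsub>G\<^esub> b) \<and> smooth_map L L (\<lambda>a. inv\<^bsub>G\<^esub> a)"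

text \<open>For a closed subgroup \<open>H\<close>: the set of all \<open>X \<in> T\<^sub>1G\<close> with \<open>exp (t X) \<in> H\<close> for all \<open>t\<close>, the map
  \<open>t \<mapsto> exp (t X)\<close> being the one-parameter subgroup with initial velocity \<open>X\<close>.\<close>

definition lie_subalgebra ::
  "('g, 'x) monoid_scheme \<Rightarrow> ('g, 'f::euclidean_space) mfd \<Rightarrow> 'g set \<Rightarrow> ('g, 'f) tvec set" where
  "lie_subalgebra G L H = {velocity L \<gamma> 0 | \<gamma>. smooth_curve L UNIV \<gamma> \<and>
     (\<forall>s t. \<gamma> (s + t) = \<gamma> s \<otimes>\<^bsub>G\<^esub> \<gamma> t) \<and> range \<gamma> \<subseteq> H}"

definition Ad ::
  "('g, 'x) monoid_scheme \<Rightarrow> ('g, 'f::euclidean_space) mfd \<Rightarrow> 'g \<Rightarrow> ('g, 'f) tvec \<Rightarrow> ('g, 'f) tvec" where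
  "Ad G L h = differential L L (\<lambda>a. h \<otimes>\<^bsub>G\<^esub> a \<otimes>\<^bsub>G\<^esub> inv\<^bsub>G\<^esub> h) \<one>\<^bsub>G\<^esub>"

text \<open>The Lie algebra of \<open>G\<close> is the tangent space at the identity.  That the subalgebra of \<open>H\<close> is
  a linear subspace of it is a theorem.\<close>

definition reductive_decomposition ::
  "('g, 'x) monoid_scheme \<Rightarrow> ('g, 'f::euclidean_space) mfd \<Rightarrow> 'g set \<Rightarrow> ('g, 'f) tvec set \<Rightarrow> bool" where
  "reductive_decomposition G L H m \<longleftrightarrow>
     m \<subseteq> tangent_space L \<one>\<^bsub>G\<^esub> \<and> tv_zero \<in> m \<and>
     (\<forall>X\<in>m. \<forall>Y\<in>m. tv_add X Y \<in> m) \<and> (\<forall>r. \<forall>X\<in>m. tv_scale r X \<in> m) \<and>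
     (\<forall>X\<in>tangent_space L \<one>\<^bsub>G\<^esub>. \<exists>!(Y, Z). Y \<in> lie_subalgebra G L H \<and> Z \<in> m \<and> X = tv_add Y Z) \<and>
     (\<forall>h\<in>H. Ad G L h ` m \<subseteq> m)"

text \<open>The manifold structure of \<open>G/H\<close> is the one, unique up to equivalence of atlases, for which
  the projection \<open>a \<mapsto> aH\<close> is a smooth submersion.\<close>

definition homogeneous_space ::
  "('g, 'x) monoid_scheme \<Rightarrow> ('g, 'f::euclidean_space) mfd \<Rightarrow> 'g set \<Rightarrow>
   ('g set, 'e::euclidean_space) mfd \<Rightarrow> bool" where
  "homogeneous_space G L H M \<longleftrightarrow>
     smooth_manifold M \<and> topspace (mtop M) = lcosets\<^bsub>G\<^esub> H \<and>
     smooth_map L M (\<lambda>a. a <#\<^bsub>G\<^esub> H) \<and>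
     (\<forall>a\<in>carrier G. differential L M (\<lambda>a. a <#\<^bsub>G\<^esub> H) a ` tangent_space L a
                      = tangent_space M (a <#\<^bsub>G\<^esub> H))"


section \<open>Riemannian metrics and 1-forms\<close>

definition linear_on_tangent ::
  "('p, 'e::euclidean_space) mfd \<Rightarrow> 'p \<Rightarrow> (('p, 'e) tvec \<Rightarrow> real) \<Rightarrow> bool" where
  "linear_on_tangent M p f \<longleftrightarrow>
     (\<forall>v\<in>tangent_space M p. \<forall>w\<in>tangent_space M p. f (tv_add v w) = f v + f w) \<and>
     (\<forall>r. \<forall>v\<in>tangent_space M p. f (tv_scale r v) = r * f v)"

definition one_form ::
  "('p, 'e::euclidean_space) mfd \<Rightarrow> ('p \<Rightarrow> ('p, 'e) tvec \<Rightarrow> real) \<Rightarrow> bool" where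
  "one_form M \<beta> \<longleftrightarrow>
     (\<forall>p\<in>topspace (mtop M). linear_on_tangent M p (\<beta> p)) \<and>
     (\<forall>c\<in>charts M. \<forall>i\<in>Basis.
        smooth_on (snd c ` fst c) (\<lambda>u. \<beta> (chart_inv c u) (tvec_of M c (chart_inv c u) i)))"

definition riemannian_metric ::
  "('p, 'e::euclidean_space) mfd \<Rightarrow> ('p \<Rightarrow> ('p, 'e) tvec \<Rightarrow> ('p, 'e) tvec \<Rightarrow> real) \<Rightarrow> bool" where
  "riemannian_metric M a \<longleftrightarrow>
     (\<forall>p\<in>topspace (mtop M).
        (\<forall>v\<in>tangent_space M p. linear_on_tangent M p (a p v)) \<and>
        (\<forall>v\<in>tangent_space M p. \<forall>w\<in>tangent_space M p. a p v w = a p w v) \<and>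
        (\<forall>v\<in>tangent_space M p. v \<noteq> tv_zero \<longrightarrow> a p v v > 0)) \<and>
     (\<forall>c\<in>charts M. \<forall>i\<in>Basis. \<forall>j\<in>Basis.
        smooth_on (snd c ` fst c)
          (\<lambda>u. a (chart_inv c u) (tvec_of M c (chart_inv c u) i) (tvec_of M c (chart_inv c u) j)))"


section \<open>Finsler metrics\<close>

text \<open>From here on the model space is \<open>real ^ 'n\<close>, so that the dimension is \<open>CARD('n)\<close>.
  A metric \<open>F\<close> comes with the domain \<open>D\<close> of nonzero tangent vectors on which it is considered.
  For \<open>D = slit_tangent_bundle M\<close> this is the usual notion of a Finsler metric (the value on zero
  vectors is 0 by homogeneity and plays no role); for smaller conic domains it is a conic Finsler
  metric.\<close>

definition local_dom ::
  "('p, real^'n) mfd \<Rightarrow> ('p \<times> ('p, real^'n) tvec) set \<Rightarrow> ('p, real^'n) chart \<Rightarrow>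
   ((real^'n) \<times> (real^'n)) set" where
  "local_dom M D c =
     {(u, y). u \<in> snd c ` fst c \<and> (chart_inv c u, tvec_of M c (chart_inv c u) y) \<in> D}"

definition local_fun ::
  "('p, real^'n) mfd \<Rightarrow> ('p \<Rightarrow> ('p, real^'n) tvec \<Rightarrow> real) \<Rightarrow> ('p, real^'n) chart \<Rightarrow>
   real^'n \<Rightarrow> real^'n \<Rightarrow> real" where
  "local_fun M F c u y = F (chart_inv c u) (tvec_of M c (chart_inv c u) y)"

definition partial_x :: "'n \<Rightarrow> (real^'n \<Rightarrow> real^'n \<Rightarrow> real) \<Rightarrow> real^'n \<Rightarrow> real^'n \<Rightarrow> real" where
  "partial_x k f x y = frechet_derivative (\<lambda>x'. f x' y) (at x) (axis k 1)"

definition partial_y :: "'n \<Rightarrow> (real^'n \<Rightarrow> real^'n \<Rightarrow> real) \<Rightarrow> real^'n \<Rightarrow> real^'n \<Rightarrow> real" where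
  "partial_y k f x y = frechet_derivative (\<lambda>y'. f x y') (at y) (axis k 1)"

definition fundamental_tensor ::
  "(real^'n \<Rightarrow> real^'n \<Rightarrow> real) \<Rightarrow> real^'n \<Rightarrow> real^'n \<Rightarrow> real^'n^'n" where
  "fundamental_tensor f x y =
     (\<chi> i j. 1/2 * partial_y i (partial_y j (\<lambda>x y. (f x y)\<^sup>2)) x y)"

definition finsler_metric_on ::
  "('p, real^'n) mfd \<Rightarrow> ('p \<times> ('p, real^'n) tvec) set \<Rightarrow>
   ('p \<Rightarrow> ('p, real^'n) tvec \<Rightarrow> real) \<Rightarrow> bool" where
  "finsler_metric_on M D F \<longleftrightarrow>
     D \<subseteq> slit_tangent_bundle M \<and>
     (\<forall>p\<in>topspace (mtop M). \<exists>y. (p, y) \<in> D) \<and>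
     (\<forall>(p, y)\<in>D. F p y > 0) \<and>
     (\<forall>(p, y)\<in>D. \<forall>r>0. (p, tv_scale r y) \<in> D \<and> F p (tv_scale r y) = r * F p y) \<and>
     (\<forall>c\<in>charts M. open (local_dom M D c) \<and>
        smooth_on (local_dom M D c) (\<lambda>(u, y). local_fun M F c u y) \<and>
        (\<forall>(u, y)\<in>local_dom M D c. \<forall>z. z \<noteq> 0 \<longrightarrow>
           z \<bullet> (fundamental_tensor (local_fun M F c) u y *v z) > 0))"

definition group_invariant ::
  "('g, 'x) monoid_scheme \<Rightarrow> ('g set, real^'n) mfd \<Rightarrow>
   ('g set \<times> ('g set, real^'n) tvec) set \<Rightarrow>
   ('g set \<Rightarrow> ('g set, real^'n) tvec \<Rightarrow> real) \<Rightarrow> bool" where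
  "group_invariant G M D F \<longleftrightarrow>
     (\<forall>g\<in>carrier G. \<forall>(p, y)\<in>D.
        (g <#\<^bsub>G\<^esub> p, differential M M (\<lambda>p. g <#\<^bsub>G\<^esub> p) p y) \<in> D \<and>
        F (g <#\<^bsub>G\<^esub> p) (differential M M (\<lambda>p. g <#\<^bsub>G\<^esub> p) p y) = F p y)"


section \<open>The infinite series metric\<close>

definition riemannian_norm ::
  "('p \<Rightarrow> ('p, 'e) tvec \<Rightarrow> ('p, 'e) tvec \<Rightarrow> real) \<Rightarrow> 'p \<Rightarrow> ('p, 'e) tvec \<Rightarrow> real" where
  "riemannian_norm a p y = sqrt (a p y y)"

definition infinite_series_metric ::
  "('p \<Rightarrow> ('p, 'e) tvec \<Rightarrow> ('p, 'e) tvec \<Rightarrow> real) \<Rightarrow> ('p \<Rightarrow> ('p, 'e) tvec \<Rightarrow> real) \<Rightarrow>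
   'p \<Rightarrow> ('p, 'e) tvec \<Rightarrow> real" where
  "infinite_series_metric a \<beta> p y = (\<beta> p y)\<^sup>2 / (\<beta> p y - riemannian_norm a p y)"

text \<open>The nonzero vectors with \<open>\<beta> > \<alpha>\<close>.  These are exactly the ones at which the quotient
  \<open>\<beta>\<^sup>2 / (\<beta> - \<alpha>)\<close> is defined and positive (and at which the series \<open>\<Sum>r. \<beta> (\<alpha>/\<beta>)^r\<close>
  that gives the metric its name converges to a positive value).  The restriction to them is
  forced: \<open>\<beta>(-y) = -\<beta>(y)\<close>, so \<open>\<beta> > \<alpha>\<close> cannot hold at both \<open>y\<close> and \<open>-y\<close>.\<close>

definition infinite_series_domain ::
  "('p, real^'n) mfd \<Rightarrow> ('p \<Rightarrow> ('p, real^'n) tvec \<Rightarrow> ('p, real^'n) tvec \<Rightarrow> real) \<Rightarrow>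
   ('p \<Rightarrow> ('p, real^'n) tvec \<Rightarrow> real) \<Rightarrow> ('p \<times> ('p, real^'n) tvec) set" where
  "infinite_series_domain M a \<beta> =
     {(p, y) \<in> slit_tangent_bundle M. riemannian_norm a p y < \<beta> p y}"

text \<open>On whichever domain the infinite series metric is a Finsler metric, in particular if it is
  supposed to be one on the whole slit tangent bundle, that domain lies in
  \<open>infinite_series_domain\<close>.\<close>

lemma finsler_domain_subset_infinite_series_domain:
  assumes "finsler_metric_on M D (infinite_series_metric a \<beta>)"
  shows "D \<subseteq> infinite_series_domain M a \<beta>"
proof
  fix z assume z: "z \<in> D"
  obtain p y where py: "z = (p, y)" by (cases z)
  have "infinite_series_metric a \<beta> p y > 0"
    using assms z py unfolding finsler_metric_on_def by blast
  then have "riemannian_norm a p y < \<beta> p y"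
    unfolding infinite_series_metric_def by (auto simp: zero_less_divide_iff)
  moreover have "z \<in> slit_tangent_bundle M"
    using assms z unfolding finsler_metric_on_def by blast
  ultimately show "z \<in> infinite_series_domain M a \<beta>"
    by (simp add: infinite_series_domain_def py)
qed

lemma infinite_series_domain_eq_slit:
  assumes "finsler_metric_on M (slit_tangent_bundle M) (infinite_series_metric a \<beta>)"
  shows "infinite_series_domain M a \<beta> = slit_tangent_bundle M"
  using finsler_domain_subset_infinite_series_domain[OF assms]
  by (auto simp: infinite_series_domain_def)


section \<open>Geodesics and S-curvature\<close>

text \<open>The spray coefficients \<open>G\<^sup>i = 1/4 g\<^sup>i\<^sup>l ([F\<^sup>2]\<^sub>x\<^sub>k\<^sub>y\<^sub>l y\<^sup>k - [F\<^sup>2]\<^sub>x\<^sub>l)\<close>; geodesics satisfy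
  \<open>x'' + 2 G(x, x') = 0\<close> in every chart.\<close>

definition spray :: "(real^'n \<Rightarrow> real^'n \<Rightarrow> real) \<Rightarrow> real^'n \<Rightarrow> real^'n \<Rightarrow> real^'n" where
  "spray f x y = matrix_inv (fundamental_tensor f x y) *v
     (\<chi> l. 1/4 * ((\<Sum>k\<in>UNIV. partial_x k (partial_y l (\<lambda>x y. (f x y)\<^sup>2)) x y * y $ k)
                    - partial_x l (\<lambda>x y. (f x y)\<^sup>2) x y))"

definition geodesic_on ::
  "('p, real^'n) mfd \<Rightarrow> ('p \<times> ('p, real^'n) tvec) set \<Rightarrow>
   ('p \<Rightarrow> ('p, real^'n) tvec \<Rightarrow> real) \<Rightarrow> real set \<Rightarrow> (real \<Rightarrow> 'p) \<Rightarrow> bool" where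
  "geodesic_on M D F I \<gamma> \<longleftrightarrow> smooth_curve M I \<gamma> \<and>
     (\<forall>t\<in>I. (\<gamma> t, velocity M \<gamma> t) \<in> D \<and>
        (\<forall>c\<in>charts_at M (\<gamma> t).
           vector_derivative (\<lambda>s. vector_derivative (snd c \<circ> \<gamma>) (at s)) (at t)
           + 2 *\<^sub>R spray (local_fun M F c) (snd c (\<gamma> t)) (vector_derivative (snd c \<circ> \<gamma>) (at t)) = 0))"

text \<open>Volume ratio and distortion, first with respect to the coordinate basis of a chart \<open>c\<close>
  around \<open>p\<close>.  The distortion itself does not depend on the basis, hence the arbitrary choice of
  a chart in \<open>distortion\<close>.\<close>

definition volume_ratio ::
  "('p, real^'n) mfd \<Rightarrow> ('p \<times> ('p, real^'n) tvec) set \<Rightarrow>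
   ('p \<Rightarrow> ('p, real^'n) tvec \<Rightarrow> real) \<Rightarrow> ('p, real^'n) chart \<Rightarrow> 'p \<Rightarrow> real" where
  "volume_ratio M D F c p =
     measure lebesgue (ball (0 :: real^'n) 1) /
     measure lebesgue {w :: real^'n. (p, tvec_of M c p w) \<in> D \<and> F p (tvec_of M c p w) < 1}"

definition distortion_in_chart ::
  "('p, real^'n) mfd \<Rightarrow> ('p \<times> ('p, real^'n) tvec) set \<Rightarrow>
   ('p \<Rightarrow> ('p, real^'n) tvec \<Rightarrow> real) \<Rightarrow> ('p, real^'n) chart \<Rightarrow>
   'p \<Rightarrow> ('p, real^'n) tvec \<Rightarrow> real" where
  "distortion_in_chart M D F c p y =
     ln (sqrt (det (fundamental_tensor (local_fun M F c) (snd c p) (y c))) / volume_ratio M D F c p)"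

definition distortion ::
  "('p, real^'n) mfd \<Rightarrow> ('p \<times> ('p, real^'n) tvec) set \<Rightarrow>
   ('p \<Rightarrow> ('p, real^'n) tvec \<Rightarrow> real) \<Rightarrow> 'p \<Rightarrow> ('p, real^'n) tvec \<Rightarrow> real" where
  "distortion M D F p y = distortion_in_chart M D F (SOME c. c \<in> charts_at M p) p y"

text \<open>\<open>has_S_curvature M D F p y s\<close> reads \<open>S(p, y) = s\<close>.\<close>

definition has_S_curvature ::
  "('p, real^'n) mfd \<Rightarrow> ('p \<times> ('p, real^'n) tvec) set \<Rightarrow>
   ('p \<Rightarrow> ('p, real^'n) tvec \<Rightarrow> real) \<Rightarrow> 'p \<Rightarrow> ('p, real^'n) tvec \<Rightarrow> real \<Rightarrow> bool" where
  "has_S_curvature M D F p y s \<longleftrightarrow>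
     (\<exists>I \<gamma>. open I \<and> is_interval I \<and> 0 \<in> I \<and> geodesic_on M D F I \<gamma> \<and>
        \<gamma> 0 = p \<and> velocity M \<gamma> 0 = y \<and>
        ((\<lambda>t. distortion M D F (\<gamma> t) (velocity M \<gamma> t)) has_real_derivative s) (at 0))"

definition isotropic_S_curvature ::
  "('p, real^'n) mfd \<Rightarrow> ('p \<times> ('p, real^'n) tvec) set \<Rightarrow>
   ('p \<Rightarrow> ('p, real^'n) tvec \<Rightarrow> real) \<Rightarrow> bool" where
  "isotropic_S_curvature M D F \<longleftrightarrow>
     (\<exists>c. smooth_function M c \<and>
        (\<forall>(p, y)\<in>D. has_S_curvature M D F p y (real (CARD('n) + 1) * c p * F p y)))"

definition vanishing_S_curvature ::
  "('p, real^'n) mfd \<Rightarrow> ('p \<times> ('p, real^'n) tvec) set \<Rightarrow>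
   ('p \<Rightarrow> ('p, real^'n) tvec \<Rightarrow> real) \<Rightarrow> bool" where
  "vanishing_S_curvature M D F \<longleftrightarrow> (\<forall>(p, y)\<in>D. has_S_curvature M D F p y 0)"

end

(* The distortion tau(p, .) tends to infinity towards the boundary beta = alpha of the cone of
   admissible directions: the Hessian of F^2/2 dominates a constant multiple of alpha^2/(s - 1)^2 on
   unit vectors, s = beta/alpha. Being positively homogeneous of degree 0, tau(p, .) therefore attains
   its minimum over that cone. Since tau is invariant under the transitive action of G, the minimum
   does not depend on p. So along a geodesic that starts in a minimizing direction y, tau has a local
   minimum at t = 0, which forces S(p, y) = 0. If S = (n + 1) c F, then c(p) = 0 as F(p, y) > 0. *)

theory Submission
  imports Defs
begin

section \<open>Linear images of measurable sets\<close>

text \<open>What a translation is assumed to preserve is F, not the pair \<alpha>, \<beta>. The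
  invariance of tau therefore rests on F alone: the differential T of a translation, written in
  charts, is linear, maps cone onto cone and carries F to F. By the chain rule it pulls Hessian back
  to Hessian, which multiplies the root of the determinant by |det T|; the volume of {F < 1} changes
  by the same factor, and the two cancel. This calls for the change of volume under linear maps of
  \<open>real^'n\<close>. It also calls for the differentiability of translations of G/H, where only
  the projection from G is known to be a smooth submersion; local sections of the projection supply
  it. The obstacle to a minimum is that the unit sphere of \<alpha> meets the open cone in a
  non-compact set. An explicit lower bound for the Hessian, valid up to \<beta> = \<alpha>, makes a
  collar of that boundary irrelevant. All estimates take place in one tangent space, for a positive
  definite bilinear form and a linear form on \<open>real^'n\<close>.\<close>

lemma det_matrix_shear:
  fixes m n :: "'n::finite"
  assumes "m \<noteq> n"
  shows "det (matrix (\<lambda>v::real^'n. \<chi> i. if i = m then v $ m + v $ n else v $ i)) = 1"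
proof -
  have eq: "matrix (\<lambda>v::real^'n. \<chi> i. if i = m then v $ m + v $ n else v $ i)
      = (\<chi> k. if k = m then row m (mat 1) + 1 *s row n (mat 1) else row k (mat 1))"
    by (auto simp: matrix_def vec_eq_iff row_def mat_def axis_def)
  show ?thesis unfolding eq det_row_operation[OF assms] by simp
qed

lemma measure_shear_cbox:
  fixes a b :: "real^'n"
  assumes "m \<noteq> n"
  shows "measure lebesgue ((\<lambda>v. \<chi> i. if i = m then v $ m + v $ n else v $ i) ` cbox a b)
    = measure lebesgue (cbox a b)"
proof (cases "cbox a b = {}")
  case False
  let ?h = "\<lambda>v::real^'n. \<chi> i. if i = m then v $ m + v $ n else v $ i"
  have add: "?h (x + y) = ?h x + ?h y" for x y by (auto simp: vec_eq_iff)
  \<comment> \<open>\<open>measure_shear_interval\<close> asks for a lower corner with nonnegative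
    n-th coordinate. Translating by d moves that coordinate to 0 and changes neither volume.\<close>
  define d :: "real^'n" where "d = axis n (- a $ n)"
  have tr: "cbox (d + a) (d + b) = (+) d ` cbox a b" by (rule cbox_translation)
  have ne: "cbox (d + a) (d + b) \<noteq> {}" and nn: "0 \<le> (d + a) $ n"
    using False by (simp_all add: tr) (simp add: d_def)
  have "measure lebesgue (?h ` cbox a b) = measure lebesgue ((+) (?h d) ` ?h ` cbox a b)"
    by (rule measure_translation[symmetric])
  also have "(+) (?h d) ` ?h ` cbox a b = ?h ` cbox (d + a) (d + b)"
    unfolding tr image_comp by (rule image_cong) (auto simp: add)
  also have "measure lebesgue (?h ` cbox (d + a) (d + b)) = measure lebesgue (cbox (d + a) (d + b))"
    by (rule measure_shear_interval) (use assms ne nn in simp_all)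
  also have "\<dots> = measure lebesgue (cbox a b)" unfolding tr by (rule measure_translation)
  finally show ?thesis .
qed simp

text \<open>The swap is an involution that carries boxes to boxes, so the image is the box with
  swapped corners; its side lengths are the old ones reindexed.\<close>

lemma measure_transpose_cbox:
  fixes a b :: "real^'n"
  shows "measure lebesgue ((\<lambda>v. \<chi> i. v $ Transposition.transpose m n i) ` cbox a b)
    = measure lebesgue (cbox a b)"
proof (cases "cbox a b = {}")
  case False
  let ?h = "\<lambda>v::real^'n. \<chi> i. v $ Transposition.transpose m n i"
  have inv: "?h (?h v) = v" for v by (simp add: vec_eq_iff)
  have maps: "?h v \<in> cbox (?h c) (?h d)" if "v \<in> cbox c d" for v c d
    using that by (simp add: mem_box_cart)
  have im: "?h ` cbox a b = cbox (?h a) (?h b)"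
  proof (intro subset_antisym subsetI)
    fix v assume "v \<in> cbox (?h a) (?h b)"
    from maps[OF this] have "?h v \<in> cbox a b" unfolding inv .
    then show "v \<in> ?h ` cbox a b" using inv[of v] by (metis imageI)
  qed (use maps in blast)
  have content: "measure lebesgue (cbox c d) = (\<Prod>i\<in>UNIV. d $ i - c $ i)"
    if "cbox c d \<noteq> {}" for c d :: "real^'n"
    using content_cbox_cart[OF that] by simp
  have "cbox (?h a) (?h b) \<noteq> {}" using False im by auto
  then have "measure lebesgue (cbox (?h a) (?h b))
      = (\<Prod>i\<in>UNIV. (\<lambda>i. b $ i - a $ i) (Transposition.transpose m n i))"
    using content[of "?h a" "?h b"] by simp
  also have "\<dots> = (\<Prod>i\<in>UNIV. b $ i - a $ i)"
    by (rule prod.reindex_bij_betw) (rule bij_transpose)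
  finally show ?thesis unfolding im content[OF False] .
qed simp

lemma det_matrix_transpose:
  fixes m n :: "'n::finite"
  shows "\<bar>det (matrix (\<lambda>v::real^'n. \<chi> i. v $ Transposition.transpose m n i))\<bar> = 1"
proof -
  have eq: "matrix (\<lambda>v::real^'n. \<chi> i. v $ Transposition.transpose m n i)
      = (\<chi> i. mat 1 $ Transposition.transpose m n i)"
  proof -
    have "matrix (\<lambda>v::real^'n. \<chi> i. v $ Transposition.transpose m n i) $ i $ j
        = (\<chi> i. mat 1 $ Transposition.transpose m n i) $ i $ j" for i j
      unfolding matrix_def vec_lambda_beta mat_def axis_def by (rule refl)
    then show ?thesis unfolding vec_eq_iff by blast
  qed
  have "sign (Transposition.transpose m n) = 1 \<or> sign (Transposition.transpose m n) = - 1"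
    unfolding sign_def by presburger
  then show ?thesis
    unfolding eq det_permute_rows[OF permutes_swap_id[OF UNIV_I UNIV_I]] by auto
qed

text \<open>The library has this only for well-ordered index types.\<close>

proposition
  fixes f :: "real^'n \<Rightarrow> real^'n"
  assumes "linear f" "T \<in> lmeasurable"
  shows measurable_linear_image_cart: "f ` T \<in> lmeasurable"
    and measure_linear_image_cart: "measure lebesgue (f ` T) = \<bar>det (matrix f)\<bar> * measure lebesgue T"
proof -
  let ?P = "\<lambda>f::real^'n \<Rightarrow> real^'n. \<forall>T\<in>lmeasurable. f ` T \<in> lmeasurable \<and>
    measure lebesgue (f ` T) = \<bar>det (matrix f)\<bar> * measure lebesgue T"
  \<comment> \<open>For swaps and shears |det| is 1, so \<open>measure_linear_sufficient\<close>
    with factor 1 reduces them to boxes.\<close>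
  have sufficient: "?P f" if "linear f" "\<And>a b. measure lebesgue (f ` cbox a b) = measure lebesgue (cbox a b)"
    "\<bar>det (matrix f)\<bar> = 1" for f
  proof
    fix T :: "(real^'n) set" assume "T \<in> lmeasurable"
    from measure_linear_sufficient[OF that(1) this, of 1] that(2)
    show "f ` T \<in> lmeasurable \<and> measure lebesgue (f ` T) = \<bar>det (matrix f)\<bar> * measure lebesgue T"
      unfolding that(3) by simp
  qed
  have "?P f"
  proof (rule induct_linear_elementary[OF \<open>linear f\<close>])
    fix f g :: "real^'n \<Rightarrow> real^'n"
    assume "linear f" "linear g" "?P f" "?P g"
    then show "?P (f \<circ> g)"
      unfolding image_comp[symmetric] matrix_compose[OF \<open>linear g\<close> \<open>linear f\<close>] det_mul abs_mult by simp
  next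
    fix f :: "real^'n \<Rightarrow> real^'n" and i
    assume f: "linear f" and "\<And>x. f x $ i = 0"
    \<comment> \<open>A vanishing coordinate makes f singular: the image is negligible and the
      determinant is 0, so both sides are 0.\<close>
    then have "axis i 1 \<notin> range f" by (metis axis_nth imageE zero_neq_one)
    then have "\<not> inj f" using linear_injective_imp_surjective[OF f] by blast
    with f have "negligible (f ` T)" "det (matrix f) = 0" for T
      using negligible_linear_singular_image det_nz_iff_inj by blast+
    then show "?P f" by (simp add: negligible_iff_measure)
  next
    fix c :: "'n \<Rightarrow> real"
    have "det (matrix (\<lambda>x::real^'n. \<chi> i. c i * x $ i)) = prod c UNIV"
      by (subst det_diagonal) (auto simp: matrix_def axis_def)
    then show "?P (\<lambda>x. \<chi> i. c i * x $ i)" by (simp add: measurable_stretch measure_stretch)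
  next
    fix m n :: 'n assume "m \<noteq> n"
    show "?P (\<lambda>x. \<chi> i. x $ Transposition.transpose m n i)"
      by (intro sufficient measure_transpose_cbox det_matrix_transpose linearI)
        (auto simp: vec_eq_iff)
    show "?P (\<lambda>x. \<chi> i. if i = m then x $ m + x $ n else x $ i)"
      by (intro sufficient measure_shear_cbox linearI)
        (auto simp: vec_eq_iff det_matrix_shear \<open>m \<noteq> n\<close> algebra_simps)
  qed
  with \<open>T \<in> lmeasurable\<close> show "f ` T \<in> lmeasurable"
    "measure lebesgue (f ` T) = \<bar>det (matrix f)\<bar> * measure lebesgue T" by blast+
qed

section \<open>The infinite series norm on a vector space\<close>

text \<open>Coercivity gives |M z| \<ge> \<kappa> |z|, so M is onto and the image of the unit ball
  contains the ball of radius \<kappa>. Comparing the two volumes bounds the determinant.\<close>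

lemma abs_det_ge_power:
  fixes M :: "real^'n^'n"
  assumes "\<kappa> > 0" and ge: "\<And>z. \<kappa> * (z \<bullet> z) \<le> z \<bullet> (M *v z)"
  shows "\<kappa> ^ CARD('n) \<le> \<bar>det M\<bar>"
proof -
  have expand: "\<kappa> * norm z \<le> norm (M *v z)" for z
  proof (cases "z = 0")
    case False
    have "\<kappa> * (norm z * norm z) \<le> norm z * norm (M *v z)"
      using ge[of z] norm_cauchy_schwarz[of z "M *v z"]
      by (simp add: power2_norm_eq_inner[symmetric] power2_eq_square)
    with False show ?thesis by simp
  qed auto
  have lin: "linear ((*v) M)" by simp
  have "inj ((*v) M)"
    unfolding linear_injective_0[OF lin]
  proof (intro allI impI)
    fix z assume "M *v z = 0"
    with expand[of z] \<open>\<kappa> > 0\<close> show "z = 0"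
      by (metis mult_le_0_iff norm_le_zero_iff norm_zero not_less)
  qed
  then have surj: "surj ((*v) M)" using linear_injective_imp_surjective[OF lin] by blast
  have sub: "ball 0 \<kappa> \<subseteq> (*v) M ` ball 0 1"
  proof
    fix y :: "real^'n" assume "y \<in> ball 0 \<kappa>"
    then have y: "norm y < \<kappa>" by simp
    obtain z where z: "y = M *v z" using surj by (metis surjD)
    have "\<kappa> * norm z < \<kappa> * 1" using expand[of z] y z by simp
    then have "norm z < 1" using \<open>\<kappa> > 0\<close> by simp
    with z show "y \<in> (*v) M ` ball 0 1" by auto
  qed
  have "measure lebesgue (ball (0::real^'n) \<kappa>) \<le> measure lebesgue ((*v) M ` ball 0 1)"
    by (rule measure_mono_fmeasurable[OF sub]) (auto intro: measurable_linear_image_cart[OF lin])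
  also have "\<dots> = \<bar>det M\<bar> * measure lebesgue (ball (0::real^'n) 1)"
    by (simp add: measure_linear_image_cart lin)
  finally have "\<kappa> ^ CARD('n) * unit_ball_vol (CARD('n)) \<le> \<bar>det M\<bar> * unit_ball_vol (CARD('n))"
    using \<open>\<kappa> > 0\<close> by (simp add: content_ball mult.commute)
  then show ?thesis by simp
qed

lemma bilinear_axis_expand:
  fixes h :: "real^'n \<Rightarrow> real^'m \<Rightarrow> real"
  assumes "bilinear h"
  shows "h x y = (\<Sum>i\<in>UNIV. \<Sum>j\<in>UNIV. x $ i * y $ j * h (axis i 1) (axis j 1))"
proof -
  interpret bounded_bilinear h using assms by (simp add: bilinear_conv_bounded_bilinear)
  have "h x y = h (\<Sum>i\<in>UNIV. x $ i *\<^sub>R axis i 1) (\<Sum>j\<in>UNIV. y $ j *\<^sub>R axis j 1)"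
    using basis_expansion[of x] basis_expansion[of y] by (simp add: scalar_mult_eq_scaleR)
  also have "\<dots> = (\<Sum>i\<in>UNIV. \<Sum>j\<in>UNIV. x $ i * y $ j * h (axis i 1) (axis j 1))"
    unfolding sum_left sum_right scaleR_left scaleR_right
    by (subst sum.swap) (simp add: sum_distrib_left mult.assoc mult.left_commute)
  finally show ?thesis .
qed

text \<open>The basis vectors appear in exchanged order because \<open>fundamental_tensor\<close>
  differentiates in direction j before direction i.\<close>

lemma inner_matrix_bilinear:
  fixes h :: "real^'n \<Rightarrow> real^'n \<Rightarrow> real"
  assumes "bilinear h"
  shows "x \<bullet> ((\<chi> i j. h (axis j 1) (axis i 1)) *v y) = h y x"
  unfolding bilinear_axis_expand[OF assms, of y x] inner_vec_def matrix_vector_mult_def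
  by (subst sum.swap) (simp add: sum_distrib_left ac_simps)

text \<open>With \<open>\<alpha>(w) = 1\<close>, \<open>s = \<beta>(w)\<close>, \<open>p = a(w, z)\<close>, \<open>a = a(z, z)\<close> and \<open>\<beta>(z) = s p + d\<close>, the right-hand side is
  the Hessian of \<open>F\<^sup>2/2\<close> at \<open>w\<close>, applied to \<open>(z, z)\<close>.\<close>

lemma infinite_series_inequality:
  fixes s b p d a :: real
  assumes "1 < s" "s \<le> b" "p\<^sup>2 \<le> a"
  defines "e \<equiv> s - 1"
  shows "min (2 / (2 + b\<^sup>2)) (1 / b) / e\<^sup>2 * a
    \<le> s\<^sup>2 / e ^ 4 * ((s * e * p + (s - 2) * d)\<^sup>2 + 2 * d\<^sup>2 + s\<^sup>2 * e * (a - p\<^sup>2))"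
proof -
  define C where "C = min (2 / (2 + b\<^sup>2)) (1 / b)"
  define x where "x = s * e * p"
  define k where "k = s - 2"
  have e: "0 < e" "e \<le> b" and b: "b > 1" using assms by auto
  have "\<bar>k\<bar> \<le> \<bar>b\<bar>" using assms(1,2) by (simp add: k_def)
  then have k: "k\<^sup>2 \<le> b\<^sup>2" by (simp add: abs_le_square_iff)
  have Ce: "C \<le> 1 / e" using e b frac_le[of 1 1 e b] by (simp add: C_def)
  have Ck: "C \<le> 2 / (2 + k\<^sup>2)"
    using frac_le[of 2 2 "2 + k\<^sup>2" "2 + b\<^sup>2"] k by (simp add: C_def add_pos_nonneg)
  have "C > 0" using b by (simp add: C_def add_pos_nonneg)
  have pos: "2 + k\<^sup>2 > 0" by (simp add: add_pos_nonneg)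
  \<comment> \<open>Minimised over d, the expression (x + k d)^2 + 2 d^2 takes the value 2 x^2 / (2
    + k^2); the identity shows the excess as a square. With |k| \<le> b this is the origin of 2 / (2
    + b^2).\<close>
  have "(2 + k\<^sup>2) * ((x + k * d)\<^sup>2 + 2 * d\<^sup>2) - 2 * x\<^sup>2 = (k * x + (2 + k\<^sup>2) * d)\<^sup>2"
    by (simp add: power2_eq_square algebra_simps)
  then have "2 * x\<^sup>2 \<le> ((x + k * d)\<^sup>2 + 2 * d\<^sup>2) * (2 + k\<^sup>2)"
    by (metis diff_ge_0_iff_ge mult.commute zero_le_power2)
  then have "2 / (2 + k\<^sup>2) * x\<^sup>2 \<le> (x + k * d)\<^sup>2 + 2 * d\<^sup>2"
    using pos by (simp add: pos_divide_le_eq)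
  moreover have "C * x\<^sup>2 \<le> 2 / (2 + k\<^sup>2) * x\<^sup>2" using Ck by (rule mult_right_mono) simp
  ultimately have 1: "C * x\<^sup>2 \<le> (x + k * d)\<^sup>2 + 2 * d\<^sup>2" by simp
  \<comment> \<open>The term with a - p^2 carries only the weight e where e^2 is wanted. The missing
    factor 1 / e is at least 1 / b, the other entry of the minimum.\<close>
  have "C * (s\<^sup>2 * e\<^sup>2 * (a - p\<^sup>2)) \<le> 1 / e * (s\<^sup>2 * e\<^sup>2 * (a - p\<^sup>2))"
    using assms(3) by (intro mult_right_mono Ce) auto
  also have "\<dots> = s\<^sup>2 * e * (a - p\<^sup>2)" using e by (simp add: power2_eq_square)
  finally have 2: "C * (s\<^sup>2 * e\<^sup>2 * (a - p\<^sup>2)) \<le> s\<^sup>2 * e * (a - p\<^sup>2)" .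
  have a: "0 \<le> a" using assms(3) by (meson order_trans zero_le_power2)
  have s4: "1 \<le> s ^ 4" using assms(1) by (simp add: one_le_power)
  have "C / e\<^sup>2 * a \<le> s ^ 4 * (C / e\<^sup>2 * a)"
    using mult_right_mono[OF s4, of "C / e\<^sup>2 * a"] \<open>C > 0\<close> a by simp
  also have "\<dots> = s\<^sup>2 / e ^ 4 * (C * x\<^sup>2 + C * (s\<^sup>2 * e\<^sup>2 * (a - p\<^sup>2)))"
    using e by (simp add: x_def power2_eq_square power4_eq_xxxx field_simps)
  also have "\<dots> \<le> s\<^sup>2 / e ^ 4 * ((x + k * d)\<^sup>2 + 2 * d\<^sup>2 + s\<^sup>2 * e * (a - p\<^sup>2))"
    using 1 2 e by (intro mult_left_mono add_mono) auto
  finally show ?thesis by (simp add: C_def x_def k_def)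
qed

text \<open>The situation in one tangent space, in the components of a chart: \<open>A v v\<close>
  is \<alpha>^2 and \<open>l\<close> is \<beta>. Below, \<open>N\<close> stands for \<alpha>,
  \<open>\<Omega>\<close> for the cone \<beta> > \<alpha> and \<open>E\<close> for F^2.\<close>

locale quadratic_linear =
  fixes A :: "real^'n \<Rightarrow> real^'n \<Rightarrow> real" and l :: "real^'n \<Rightarrow> real"
  assumes bilinear_A: "bilinear A" and sym_A: "A v w = A w v"
    and pos_A: "v \<noteq> 0 \<Longrightarrow> A v v > 0" and linear_l: "linear l"
begin

lemma bb_A: "bounded_bilinear A"
  using bilinear_A by (simp add: bilinear_conv_bounded_bilinear)

lemmas A_simps = bounded_bilinear.scaleR_left[OF bb_A] bounded_bilinear.scaleR_right[OF bb_A]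
  bounded_bilinear.add_left[OF bb_A] bounded_bilinear.add_right[OF bb_A]
  bounded_bilinear.zero_left[OF bb_A] bounded_bilinear.diff_left[OF bb_A]
  bounded_bilinear.diff_right[OF bb_A]

lemmas l_simps = linear_scale[OF linear_l] linear_add[OF linear_l] linear_0[OF linear_l]

lemma bl_l: "bounded_linear l"
  using linear_l by (simp add: linear_conv_bounded_linear)

lemmas A_der = bounded_bilinear.FDERIV[OF bb_A]
lemmas l_der = bounded_linear.has_derivative[OF bl_l]

lemma cont_A [continuous_intros]:
  "continuous_on S f \<Longrightarrow> continuous_on S g \<Longrightarrow> continuous_on S (\<lambda>x. A (f x) (g x))"
  by (rule bounded_bilinear.continuous_on[OF bb_A])

lemma cont_l [continuous_intros]: "continuous_on S f \<Longrightarrow> continuous_on S (\<lambda>x. l (f x))"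
  by (rule bounded_linear.continuous_on[OF bl_l])

definition N :: "real^'n \<Rightarrow> real" where "N w = sqrt (A w w)"
definition \<Omega> :: "(real^'n) set" where "\<Omega> = {w. w \<noteq> 0 \<and> N w < l w}"
definition E :: "real^'n \<Rightarrow> real" where "E w = ((l w)\<^sup>2 / (l w - N w))\<^sup>2"

text \<open>Read E = l^4 / (l - N)^2 as a function of two variables. Then \<open>c_l\<close> is its
  partial derivative in l and \<open>c_A\<close> is its partial derivative in N divided by N,
  because the derivative of \<open>N\<close> in direction v is \<open>A w v / N w\<close>.\<close>

definition c_l :: "real^'n \<Rightarrow> real" where
  "c_l w = 4 * l w ^ 3 / (l w - N w) ^ 2 - 2 * l w ^ 4 / (l w - N w) ^ 3"
definition c_A :: "real^'n \<Rightarrow> real" where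
  "c_A w = 2 * l w ^ 4 / (N w * (l w - N w) ^ 3)"
definition E1 :: "real^'n \<Rightarrow> real^'n \<Rightarrow> real" where
  "E1 w v = c_l w * l v + c_A w * A w v"
text \<open>Coefficients of the derivatives of \<open>c_l\<close> and \<open>c_A\<close>. The same
  \<open>c_lA\<close> occurs in both, as the mixed second derivative; the last term of
  \<open>E2\<close> comes from differentiating \<open>A w v\<close> in w.\<close>

definition c_ll :: "real^'n \<Rightarrow> real" where
  "c_ll w = 12 * l w ^ 2 / (l w - N w) ^ 2 - 16 * l w ^ 3 / (l w - N w) ^ 3
    + 6 * l w ^ 4 / (l w - N w) ^ 4"
definition c_lA :: "real^'n \<Rightarrow> real" where
  "c_lA w = 8 * l w ^ 3 / (N w * (l w - N w) ^ 3) - 6 * l w ^ 4 / (N w * (l w - N w) ^ 4)"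
definition c_AA :: "real^'n \<Rightarrow> real" where
  "c_AA w = 6 * l w ^ 4 / (N w ^ 2 * (l w - N w) ^ 4) - 2 * l w ^ 4 / (N w ^ 3 * (l w - N w) ^ 3)"
definition E2 :: "real^'n \<Rightarrow> real^'n \<Rightarrow> real^'n \<Rightarrow> real" where
  "E2 w v z = c_ll w * (l v * l z) + c_lA w * (l v * A w z + A w v * l z)
    + c_AA w * (A w v * A w z) + c_A w * A v z"

section \<open>First and second derivatives of the squared metric on the cone\<close>

lemma N_pos: "w \<noteq> 0 \<Longrightarrow> N w > 0" by (simp add: N_def pos_A)

lemma cont_N [continuous_intros]: "continuous_on S f \<Longrightarrow> continuous_on S (\<lambda>x. N (f x))"
  unfolding N_def by (intro continuous_intros)

lemma open_\<Omega>: "open \<Omega>"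
  unfolding \<Omega>_def by (intro open_Collect_conj open_Collect_neq open_Collect_less continuous_intros)

lemma N_der:
  assumes "w \<noteq> 0"
  shows "(N has_derivative (\<lambda>v. A w v / N w)) (at w)"
proof -
  have A: "A w w > 0" using assms by (rule pos_A)
  have "((\<lambda>w. A w w) has_derivative (\<lambda>v. 2 * A w v)) (at w)"
    by (rule has_derivative_eq_rhs[OF A_der[OF has_derivative_ident has_derivative_ident]])
      (simp add: fun_eq_iff sym_A)
  from has_derivative_real_sqrt[OF A this] show ?thesis
    by (simp add: N_def[abs_def] field_simps)
qed

lemma E_der:
  assumes "w \<in> \<Omega>"
  shows "(E has_derivative E1 w) (at w)"
proof -
  have w: "w \<noteq> 0" "N w > 0" "l w - N w \<noteq> 0" using assms N_pos by (auto simp: \<Omega>_def)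
  define u where "u = l w - N w"
  show ?thesis
    unfolding E_def
    apply (rule derivative_eq_intros l_der N_der w refl)+
    unfolding E1_def c_l_def c_A_def
    using w unfolding u_def[symmetric]
    by (auto simp: fun_eq_iff field_simps power2_eq_square power3_eq_cube power4_eq_xxxx)
qed

lemma c_l_der:
  assumes "w \<in> \<Omega>"
  shows "(c_l has_derivative (\<lambda>z. c_ll w * l z + c_lA w * A w z)) (at w)"
proof -
  have w: "w \<noteq> 0" "N w > 0" "l w - N w \<noteq> 0" "(l w - N w) ^ 3 \<noteq> 0" "(l w - N w) ^ 2 \<noteq> 0"
    using assms N_pos by (auto simp: \<Omega>_def)
  show ?thesis
    unfolding c_l_def
    apply (rule derivative_eq_intros l_der N_der w refl)+
    apply (rule ext)
    subgoal for z
    proof -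
      \<comment> \<open>The identity of rational functions holds even with the difference u, the
        values s and n, and the derivatives x and y as independent unknowns, so all of them are made
        atoms before denominators are cleared.\<close>
      define u where "u = l w - N w"
      define x where "x = l z"
      define y where "y = A w z"
      define n where "n = N w"
      define s where "s = l w"
      have "n \<noteq> 0" "u \<noteq> 0" using w by (auto simp: n_def u_def)
      then show ?thesis
        unfolding c_ll_def c_lA_def u_def[symmetric]
        unfolding x_def[symmetric] y_def[symmetric] n_def[symmetric] s_def[symmetric]
        by (simp add: field_simps eval_nat_numeral)
    qed
    done
qed

lemma c_A_der:
  assumes "w \<in> \<Omega>"
  shows "(c_A has_derivative (\<lambda>z. c_lA w * l z + c_AA w * A w z)) (at w)"
proof -
  have w: "w \<noteq> 0" "N w > 0" "l w - N w \<noteq> 0" "(l w - N w) ^ 3 \<noteq> 0" "N w * (l w - N w) ^ 3 \<noteq> 0"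
    using assms N_pos[of w] by (auto simp: \<Omega>_def)
  show ?thesis
    unfolding c_A_def
    apply (rule derivative_eq_intros l_der N_der w refl)+
    apply (rule ext)
    subgoal for z
    proof -
      define u where "u = l w - N w"
      define x where "x = l z"
      define y where "y = A w z"
      define n where "n = N w"
      define s where "s = l w"
      have "n \<noteq> 0" "u \<noteq> 0" using w by (auto simp: n_def u_def)
      then show ?thesis
        unfolding c_AA_def c_lA_def u_def[symmetric]
        unfolding x_def[symmetric] y_def[symmetric] n_def[symmetric] s_def[symmetric]
        by (simp add: field_simps eval_nat_numeral)
    qed
    done
qed

lemma E1_der:
  assumes "w \<in> \<Omega>"
  shows "((\<lambda>w. E1 w v) has_derivative E2 w v) (at w)"
  unfolding E1_def
  apply (rule derivative_eq_intros c_l_der c_A_der A_der assms refl)+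
  by (simp add: fun_eq_iff E2_def algebra_simps A_simps sym_A)

lemma cont_E2: "continuous_on \<Omega> (\<lambda>w. E2 w v z)"
proof -
  have "N w \<noteq> 0" "l w - N w \<noteq> 0" if "w \<in> \<Omega>" for w using that N_pos[of w] by (auto simp: \<Omega>_def)
  then show ?thesis
    unfolding E2_def c_ll_def c_lA_def c_AA_def c_A_def
    by (intro continuous_intros) auto
qed

lemma bilinear_E2: "bilinear (E2 w)"
  unfolding bilinear_def E2_def
  by (auto intro!: linearI simp: A_simps l_simps algebra_simps)

lemma N_scale: "r > 0 \<Longrightarrow> N (r *\<^sub>R w) = r * N w"
  by (simp add: N_def A_simps real_sqrt_mult)

text \<open>The Hessian of a function of degree 2 has degree 0. The degrees -1 of
  \<open>c_lA\<close> and -2 of \<open>c_AA\<close> are made up for by the factors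
  \<open>A w v\<close> and \<open>A w z\<close>.\<close>

lemma E2_scale:
  assumes "r > 0" "w \<in> \<Omega>" shows "E2 (r *\<^sub>R w) v z = E2 w v z"
proof -
  have w: "w \<noteq> 0" "N w > 0" "l w - N w \<noteq> 0" using assms N_pos by (auto simp: \<Omega>_def)
  define u where "u = l w - N w"
  have u: "r * l w - r * N w = r * u" by (simp add: u_def algebra_simps)
  have eqs: "c_ll (r *\<^sub>R w) = c_ll w" "c_lA (r *\<^sub>R w) = c_lA w / r"
    "c_AA (r *\<^sub>R w) = c_AA w / r\<^sup>2" "c_A (r *\<^sub>R w) = c_A w"
    using w assms(1)
    unfolding c_ll_def c_lA_def c_AA_def c_A_def N_scale[OF assms(1)] l_simps real_scaleR_def
      u u_def[symmetric]
    by (simp_all add: field_simps eval_nat_numeral)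
  show ?thesis unfolding E2_def A_simps eqs using assms(1) by (simp add: power2_eq_square field_simps)
qed

section \<open>Lower bounds for the Hessian and its determinant\<close>

lemma cauchy_schwarz_A: assumes "N w = 1" shows "(A w z)\<^sup>2 \<le> A z z"
proof -
  have ww: "A w w = 1" using assms by (simp add: N_def)
  \<comment> \<open>The component of z that is A-orthogonal to w.\<close>
  define v where "v = z - A w z *\<^sub>R w"
  have "0 \<le> A v v" using pos_A[of v] by (cases "v = 0") (auto simp: A_simps)
  also have "A v v = A z z - (A w z)\<^sup>2"
    by (simp add: v_def A_simps ww sym_A[of z w] power2_eq_square)
  finally show ?thesis by simp
qed

lemma E2_lower_bound:
  assumes w: "N w = 1" "1 < l w" "l w \<le> b"
  shows "min (2 / (2 + b\<^sup>2)) (1 / b) / (l w - 1)\<^sup>2 * A z z \<le> 1 / 2 * E2 w z z"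
proof -
  define s where "s = l w"
  define p where "p = A w z"
  \<comment> \<open>Split z = p w + z' with z' A-orthogonal to w. Then d = l z' and a - p^2 = A z'
    z', and in these variables the Hessian is a sum of nonnegative terms.\<close>
  define d where "d = l z - s * p"
  define e where "e = s - 1"
  define a where "a = A z z"
  have lz: "l z = s * p + d" by (simp add: d_def)
  have s: "s = e + 1" and e: "e > 0" using w by (auto simp: e_def s_def)
  have "min (2 / (2 + b\<^sup>2)) (1 / b) / e\<^sup>2 * a
      \<le> s\<^sup>2 / e ^ 4 * ((s * e * p + (s - 2) * d)\<^sup>2 + 2 * d\<^sup>2 + s\<^sup>2 * e * (a - p\<^sup>2))"
    unfolding e_def by (rule infinite_series_inequality) (use w cauchy_schwarz_A in \<open>auto simp: s_def p_def a_def\<close>)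
  also have "\<dots> = 1 / 2 * E2 w z z"
    unfolding E2_def c_ll_def c_lA_def c_AA_def c_A_def w(1) s_def[symmetric] lz p_def[symmetric]
      a_def[symmetric] e_def[symmetric]
    unfolding s using e by (simp add: field_simps eval_nat_numeral)
  finally show ?thesis by (simp add: s_def e_def a_def)
qed

definition g :: "real^'n \<Rightarrow> real^'n^'n" where
  "g w = (\<chi> i j. 1 / 2 * E2 w (axis j 1) (axis i 1))"

lemma inner_g: "x \<bullet> (g w *v y) = 1 / 2 * E2 w y x"
proof -
  have "bilinear (\<lambda>y x. 1 / 2 * E2 w y x)"
    using bilinear_E2[of w] by (auto simp: bilinear_def linear_iff algebra_simps)
  from inner_matrix_bilinear[OF this] show ?thesis by (simp add: g_def)
qed

lemma cont_det_g: "continuous_on \<Omega> (\<lambda>w. det (g w))"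
  unfolding det_def g_def by (auto intro!: continuous_intros cont_E2)

lemma g_scale: "r > 0 \<Longrightarrow> w \<in> \<Omega> \<Longrightarrow> g (r *\<^sub>R w) = g w"
  by (simp add: g_def E2_scale)

text \<open>\<mu> is the minimum of A on the Euclidean unit sphere. It mediates between
  \<open>E2_lower_bound\<close>, which is stated with A, and \<open>abs_det_ge_power\<close>, which
  is stated with the Euclidean inner product.\<close>

lemma A_coercive: obtains \<mu> where "\<mu> > 0" "\<And>z. \<mu> * (z \<bullet> z) \<le> A z z"
proof -
  have "continuous_on (sphere 0 1) (\<lambda>z. A z z)" by (intro continuous_intros)
  moreover have "sphere 0 1 \<noteq> ({} :: (real^'n) set)" by simp
  ultimately obtain z0 :: "real^'n" where z0: "norm z0 = 1" "\<And>z. norm z = 1 \<Longrightarrow> A z0 z0 \<le> A z z"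
    using continuous_attains_inf[OF compact_sphere, of 0 1 "\<lambda>z. A z z"] by (auto simp: dist_norm)
  show thesis
  proof
    show "A z0 z0 > 0" using z0(1) by (intro pos_A) auto
    fix z :: "real^'n"
    show "A z0 z0 * (z \<bullet> z) \<le> A z z"
    proof (cases "z = 0")
      case False
      have "A z0 z0 \<le> A (z /\<^sub>R norm z) (z /\<^sub>R norm z)" by (rule z0(2)) (use False in simp)
      also have "\<dots> = A z z / (norm z * norm z)" unfolding A_simps by (simp add: field_simps)
      finally show ?thesis using False
        by (simp add: pos_le_divide_eq power2_norm_eq_inner[symmetric] power2_eq_square)
    qed (simp add: A_simps)
  qed
qed

lemma compact_unit: "compact {w. N w = 1}"
proof -
  obtain \<mu> where \<mu>: "\<mu> > 0" "\<And>z. \<mu> * (z \<bullet> z) \<le> A z z" by (rule A_coercive) blast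
  have "closed {w. N w = 1}" by (intro closed_Collect_eq continuous_intros)
  moreover have "{w. N w = 1} \<subseteq> cball 0 (sqrt (1 / \<mu>))"
  proof
    fix w assume "w \<in> {w. N w = 1}"
    then have "A w w = 1" by (simp add: N_def)
    with \<mu>(2)[of w] \<open>\<mu> > 0\<close> have "w \<bullet> w \<le> 1 / \<mu>" by (simp add: field_simps)
    then show "w \<in> cball 0 (sqrt (1 / \<mu>))" by (simp add: norm_eq_sqrt_inner)
  qed
  ultimately show ?thesis by (metis bounded_cball bounded_subset compact_eq_bounded_closed)
qed

text \<open>For fixed \<mu> and b the bound tends to infinity as \<open>l w\<close> decreases to 1,
  that is, as a unit vector approaches the boundary of the cone. This makes up for the missing
  compactness.\<close>

lemma abs_det_g_lower_bound:
  assumes \<mu>: "\<mu> > 0" "\<And>z. \<mu> * (z \<bullet> z) \<le> A z z" and w: "w \<in> \<Omega>" "N w = 1" "l w \<le> b"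
  shows "(min (2 / (2 + b\<^sup>2)) (1 / b) * \<mu> / (l w - 1)\<^sup>2) ^ CARD('n) \<le> \<bar>det (g w)\<bar>"
proof -
  have e: "0 < l w - 1" using w by (simp add: \<Omega>_def)
  then have "b > 1" using w by simp
  then have m: "0 < min (2 / (2 + b\<^sup>2)) (1 / b)" by (simp add: add_pos_nonneg)
  show ?thesis
  proof (rule abs_det_ge_power)
    show "0 < min (2 / (2 + b\<^sup>2)) (1 / b) * \<mu> / (l w - 1)\<^sup>2" using m \<mu>(1) e by simp
    fix z :: "real^'n"
    have "min (2 / (2 + b\<^sup>2)) (1 / b) * \<mu> / (l w - 1)\<^sup>2 * (z \<bullet> z)
        = min (2 / (2 + b\<^sup>2)) (1 / b) / (l w - 1)\<^sup>2 * (\<mu> * (z \<bullet> z))" by simp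
    also have "\<dots> \<le> min (2 / (2 + b\<^sup>2)) (1 / b) / (l w - 1)\<^sup>2 * A z z"
      using m by (intro mult_left_mono \<mu>(2) divide_nonneg_nonneg) auto
    also have "\<dots> \<le> z \<bullet> (g w *v z)"
      unfolding inner_g using w e by (intro E2_lower_bound) auto
    finally show "min (2 / (2 + b\<^sup>2)) (1 / b) * \<mu> / (l w - 1)\<^sup>2 * (z \<bullet> z) \<le> z \<bullet> (g w *v z)" .
  qed
qed

lemma normalize_\<Omega>:
  assumes "v \<in> \<Omega>" shows "\<exists>w. w \<in> \<Omega> \<and> N w = 1 \<and> g w = g v"
proof -
  have v: "N v > 0" "N v < l v" "v \<noteq> 0" using assms N_pos by (auto simp: \<Omega>_def)
  have r: "1 / N v > 0" using v by simp
  have "N ((1 / N v) *\<^sub>R v) = 1" using N_scale[OF r, of v] v by simp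
  moreover have "l ((1 / N v) *\<^sub>R v) > 1" using v by (simp add: l_simps)
  ultimately have "(1 / N v) *\<^sub>R v \<in> \<Omega>" using v by (simp add: \<Omega>_def)
  with \<open>N ((1 / N v) *\<^sub>R v) = 1\<close> g_scale[OF r assms] show ?thesis by blast
qed

lemma abs_det_g_attains_min:
  assumes "\<Omega> \<noteq> {}"
  obtains w where "w \<in> \<Omega>" "\<And>v. v \<in> \<Omega> \<Longrightarrow> \<bar>det (g w)\<bar> \<le> \<bar>det (g v)\<bar>"
proof -
  obtain u where "u \<in> \<Omega>" using assms by blast
  from normalize_\<Omega>[OF this] obtain w0 where w0: "w0 \<in> \<Omega>" "N w0 = 1" by blast
  obtain \<mu> where \<mu>: "\<mu> > 0" "\<And>z. \<mu> * (z \<bullet> z) \<le> A z z" by (rule A_coercive) blast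
  obtain b where b: "\<And>w. N w = 1 \<Longrightarrow> l w \<le> b"
    using continuous_attains_sup[OF compact_unit, of l] w0(2) cont_l[OF continuous_on_id] by auto
  define C where "C = min (2 / (2 + b\<^sup>2)) (1 / b) * \<mu>"
  \<comment> \<open>A level above the value at the reference vector w0. The summand 1 ensures K
    \<ge> 1, hence K \<le> K ^ n, which matches the n-th power in the determinant bound.\<close>
  define K where "K = \<bar>det (g w0)\<bar> + 1"
  have w0': "1 < l w0" using w0 by (simp add: \<Omega>_def)
  with b[OF w0(2)] have "b > 1" by simp
  then have "C > 0" using \<mu>(1) by (simp add: C_def add_pos_nonneg)
  have "K \<ge> 1" by (simp add: K_def)
  \<comment> \<open>The first bound keeps w0 out of the collar l w < 1 + \<delta>; the second forces
    C / (l w - 1)^2 \<ge> K inside it.\<close>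
  define \<delta> where "\<delta> = min (l w0 - 1) (sqrt (C / K))"
  have \<delta>: "\<delta> > 0" "\<delta>\<^sup>2 \<le> C / K"
  proof -
    show "\<delta> > 0" using w0' \<open>C > 0\<close> \<open>K \<ge> 1\<close> by (simp add: \<delta>_def)
    then have "\<delta>\<^sup>2 \<le> (sqrt (C / K))\<^sup>2" by (intro power_mono) (auto simp: \<delta>_def)
    then show "\<delta>\<^sup>2 \<le> C / K" using \<open>C > 0\<close> \<open>K \<ge> 1\<close> by simp
  qed
  have large: "K \<le> \<bar>det (g w)\<bar>" if w: "w \<in> \<Omega>" "N w = 1" "l w < 1 + \<delta>" for w
  proof -
    have e: "0 < l w - 1" "l w - 1 < \<delta>" using w by (auto simp: \<Omega>_def)
    then have "(l w - 1)\<^sup>2 \<le> \<delta>\<^sup>2" by (intro power_mono) auto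
    also note \<delta>(2)
    finally have "K \<le> C / (l w - 1)\<^sup>2" using \<open>K \<ge> 1\<close> e by (simp add: field_simps)
    have "(C / (l w - 1)\<^sup>2) ^ CARD('n) \<le> \<bar>det (g w)\<bar>"
      unfolding C_def by (rule abs_det_g_lower_bound[OF \<mu> w(1,2) b[OF w(2)]])
    moreover have "K \<le> K ^ CARD('n)" using \<open>K \<ge> 1\<close> by (intro self_le_power) auto
    moreover have "K ^ CARD('n) \<le> (C / (l w - 1)\<^sup>2) ^ CARD('n)"
      using \<open>K \<le> C / (l w - 1)\<^sup>2\<close> \<open>K \<ge> 1\<close> by (intro power_mono) auto
    ultimately show ?thesis by linarith
  qed
  \<comment> \<open>The unit vectors outside the collar form a compact subset of the cone that
    contains w0. A minimum over it is global, since every value in the collar exceeds the one at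
    w0.\<close>
  define T where "T = {w. N w = 1} \<inter> {w. 1 + \<delta> \<le> l w}"
  have "compact T"
    unfolding T_def by (intro compact_Int_closed compact_unit closed_Collect_le continuous_intros)
  moreover have "w0 \<in> T" using w0 by (auto simp: T_def \<delta>_def)
  moreover have "T \<subseteq> \<Omega>" using \<delta>(1) by (auto simp: T_def \<Omega>_def N_def A_simps)
  then have "continuous_on T (\<lambda>w. \<bar>det (g w)\<bar>)"
    by (intro continuous_intros continuous_on_subset[OF cont_det_g])
  ultimately obtain w where w: "w \<in> T" "\<And>v. v \<in> T \<Longrightarrow> \<bar>det (g w)\<bar> \<le> \<bar>det (g v)\<bar>"
    using continuous_attains_inf[of T "\<lambda>w. \<bar>det (g w)\<bar>"] by blast
  show thesis
  proof
    show "w \<in> \<Omega>" using w(1) \<open>T \<subseteq> \<Omega>\<close> by blast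
    fix v assume "v \<in> \<Omega>"
    then obtain v' where v': "v' \<in> \<Omega>" "N v' = 1" "g v' = g v" using normalize_\<Omega> by blast
    show "\<bar>det (g w)\<bar> \<le> \<bar>det (g v)\<bar>"
    proof (cases "v' \<in> T")
      case True
      then show ?thesis using w(2) v'(3) by metis
    next
      case False
      then have "K \<le> \<bar>det (g v')\<bar>" using v' by (intro large) (auto simp: T_def)
      moreover have "\<bar>det (g w)\<bar> \<le> \<bar>det (g w0)\<bar>" using w(2) \<open>w0 \<in> T\<close> by blast
      ultimately show ?thesis using v'(3) by (simp add: K_def)
    qed
  qed
qed

text \<open>For a single unit vector w, the bound b may be \<open>l w\<close> itself.\<close>

lemma det_g_nonzero:
  assumes "v \<in> \<Omega>" shows "det (g v) \<noteq> 0"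
proof -
  obtain w where w: "w \<in> \<Omega>" "N w = 1" "g w = g v" using normalize_\<Omega>[OF assms] by blast
  obtain \<mu> where \<mu>: "\<mu> > 0" "\<And>z. \<mu> * (z \<bullet> z) \<le> A z z" by (rule A_coercive) blast
  have "1 < l w" using w by (simp add: \<Omega>_def)
  then have "0 < (min (2 / (2 + (l w)\<^sup>2)) (1 / l w) * \<mu> / (l w - 1)\<^sup>2) ^ CARD('n)"
    using \<mu>(1) by (intro zero_less_power divide_pos_pos mult_pos_pos) (auto simp: add_pos_nonneg)
  also have "\<dots> \<le> \<bar>det (g w)\<bar>" by (rule abs_det_g_lower_bound[OF \<mu> w(1,2) order_refl])
  finally show ?thesis using w(3) by simp
qed

section \<open>Volume and distortion in one tangent space\<close>

definition K :: "(real^'n) set" where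
  "K = {w \<in> \<Omega>. (l w)\<^sup>2 / (l w - N w) < 1}"

lemma K_lmeasurable: "K \<in> lmeasurable"
proof (rule lmeasurable_open)
  have "continuous_on \<Omega> (\<lambda>w. (l w)\<^sup>2 / (l w - N w))"
    by (intro continuous_intros) (auto simp: \<Omega>_def)
  moreover have "K = \<Omega> \<inter> (\<lambda>w. (l w)\<^sup>2 / (l w - N w)) -` {..<1}" by (auto simp: K_def)
  ultimately show "open K" using continuous_open_preimage[OF _ open_\<Omega> open_lessThan] by metis
  obtain \<mu> where \<mu>: "\<mu> > 0" "\<And>z. \<mu> * (z \<bullet> z) \<le> A z z" by (rule A_coercive) blast
  show "bounded K"
  proof (rule bounded_subset[OF bounded_cball])
    show "K \<subseteq> cball 0 (sqrt (1 / \<mu>))"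
    proof
      fix w assume "w \<in> K"
      then have w: "w \<noteq> 0" "N w < l w" "(l w)\<^sup>2 / (l w - N w) < 1" by (auto simp: K_def \<Omega>_def)
      then have "(l w)\<^sup>2 < l w - N w" by simp
      \<comment> \<open>Completing the square bounds l w - (l w)^2 by 1/4, so F < 1 keeps
        \<open>N w\<close> bounded although the cone is not.\<close>
      moreover have "0 \<le> (l w - 1 / 2)\<^sup>2" by simp
      ultimately have "N w \<le> 1" by (simp add: power2_eq_square algebra_simps)
      moreover have "A w w \<ge> 0" using pos_A[OF w(1)] by simp
      ultimately have "A w w \<le> 1" unfolding N_def using real_sqrt_le_iff[of "A w w" 1] by simp
      with \<mu>(2)[of w] \<open>\<mu> > 0\<close> have "w \<bullet> w \<le> 1 / \<mu>" by (simp add: field_simps)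
      then show "w \<in> cball 0 (sqrt (1 / \<mu>))" by (simp add: norm_eq_sqrt_inner)
    qed
  qed
qed

definition \<tau> :: "real^'n \<Rightarrow> real" where
  "\<tau> w = ln (sqrt (det (g w)) / (measure lebesgue (ball (0::real^'n) 1) / measure lebesgue K))"

lemma \<tau>_attains_min:
  assumes "\<Omega> \<noteq> {}"
  obtains w where "w \<in> \<Omega>" "\<And>v. v \<in> \<Omega> \<Longrightarrow> \<tau> w \<le> \<tau> v"
proof -
  obtain w where w: "w \<in> \<Omega>" "\<And>v. v \<in> \<Omega> \<Longrightarrow> \<bar>det (g w)\<bar> \<le> \<bar>det (g v)\<bar>"
    using abs_det_g_attains_min[OF assms] by blast
  define C where "C = measure lebesgue K / measure lebesgue (ball (0::real^'n) 1)"
  \<comment> \<open>In HOL \<open>sqrt\<close> is odd and \<open>ln\<close> is even on the reals, so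
    \<tau> depends on the determinant only through its absolute value, the quantity minimised
    above.\<close>
  have \<tau>: "\<tau> v = ln (sqrt \<bar>det (g v)\<bar> * C)" for v
  proof (cases "det (g v) < 0")
    case True
    then have "sqrt (det (g v)) * C = - (sqrt \<bar>det (g v)\<bar> * C)" by (simp add: real_sqrt_minus)
    then show ?thesis unfolding \<tau>_def C_def by (simp add: ln_minus)
  qed (simp add: \<tau>_def C_def)
  have "\<tau> w \<le> \<tau> v" if "v \<in> \<Omega>" for v
  \<comment> \<open>If C = 0, both sides are \<open>ln 0\<close>; otherwise the arguments of
    \<open>ln\<close> are positive and monotonicity applies.\<close>
  proof (cases "C = 0")
    case False
    then have "C > 0" by (simp add: C_def divide_nonneg_nonneg order_less_le)
    then have "sqrt \<bar>det (g w)\<bar> * C \<le> sqrt \<bar>det (g v)\<bar> * C"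
      using w(2)[OF that] by simp
    moreover have "sqrt \<bar>det (g w)\<bar> * C > 0" using det_g_nonzero[OF w(1)] \<open>C > 0\<close> by simp
    ultimately show ?thesis unfolding \<tau> by (subst ln_le_cancel_iff) linarith+
  qed (simp add: \<tau>)
  with w(1) show thesis by (rule that)
qed

lemma fundamental_tensor_eq_g:
  assumes f: "\<And>y. (f x y)\<^sup>2 = E y" and w: "w \<in> \<Omega>"
  shows "fundamental_tensor f x w = g w"
proof -
  have 1: "partial_y j (\<lambda>x y. (f x y)\<^sup>2) x y = E1 y (axis j 1)" if "y \<in> \<Omega>" for j y
    unfolding partial_y_def f using frechet_derivative_at[OF E_der[OF that]] by simp
  have "partial_y i (partial_y j (\<lambda>x y. (f x y)\<^sup>2)) x w = E2 w (axis j 1) (axis i 1)" for i j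
  proof -
    \<comment> \<open>On the open set \<Omega> the first partial derivative is \<open>E1\<close>,
      which may replace it before the second differentiation.\<close>
    have "((\<lambda>y. partial_y j (\<lambda>x y. (f x y)\<^sup>2) x y) has_derivative E2 w (axis j 1)) (at w)"
      by (rule has_derivative_transform_within_open[OF E1_der[OF w] open_\<Omega> w]) (simp add: 1)
    from frechet_derivative_at[OF this] show ?thesis by (simp add: partial_y_def)
  qed
  then show ?thesis by (simp add: fundamental_tensor_def g_def)
qed

end

section \<open>Behaviour of the distortion under linear maps\<close>

lemma matrix_eqI_inner:
  fixes P Q :: "real^'n^'m"
  assumes "\<And>x y. x \<bullet> (P *v y) = x \<bullet> (Q *v y)"
  shows "P = Q"
  unfolding matrix_eq using assms vector_eq_ldot by blast

lemma inner_transpose: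
  fixes S :: "real^'n^'m"
  shows "x \<bullet> (transpose S *v u) = (S *v x) \<bullet> u"
  unfolding transpose_matrix_vector using dot_lmul_matrix[of u S x] by (simp add: inner_commute)

text \<open>T carries one metric to the other, but need not carry A1 to A2 or l1 to l2. The chain
  rule applied to the squared metrics relates the Hessians by T, the sets {F < 1} correspond under
  T, and |det T| occurs once in each factor of the distortion and cancels.\<close>

lemma \<tau>_linear_invariant:
  fixes A1 A2 :: "real^'n \<Rightarrow> real^'n \<Rightarrow> real"
  assumes q1: "quadratic_linear A1 l1" and q2: "quadratic_linear A2 l2"
    and T: "linear T" "T ` quadratic_linear.\<Omega> A1 l1 = quadratic_linear.\<Omega> A2 l2"
    and F: "\<And>w. w \<in> quadratic_linear.\<Omega> A1 l1 \<Longrightarrow>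
      (l2 (T w))\<^sup>2 / (l2 (T w) - quadratic_linear.N A2 (T w)) = (l1 w)\<^sup>2 / (l1 w - quadratic_linear.N A1 w)"
    and w: "w \<in> quadratic_linear.\<Omega> A1 l1"
  shows "quadratic_linear.\<tau> A1 l1 w = quadratic_linear.\<tau> A2 l2 (T w)"
proof -
  interpret q1: quadratic_linear A1 l1 by (rule q1)
  interpret q2: quadratic_linear A2 l2 by (rule q2)
  have blT: "bounded_linear T" using T(1) by (simp add: linear_conv_bounded_linear)
  have T_der: "(T has_derivative T) (at w)" for w by (rule bounded_linear_imp_has_derivative[OF blT])
  have T_\<Omega>: "T w \<in> q2.\<Omega>" if "w \<in> q1.\<Omega>" for w using that T(2) by blast
  \<comment> \<open>This holds on the whole cone, because it is differentiated once more; the second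
    derivatives are compared at w only.\<close>
  have E1: "q1.E1 w v = q2.E1 (T w) (T v)" if "w \<in> q1.\<Omega>" for w v
  proof -
    have "((q2.E \<circ> T) has_derivative (q2.E1 (T w) \<circ> T)) (at w)"
      by (rule diff_chain_at[OF T_der q2.E_der[OF T_\<Omega>[OF that]]])
    then have "(q1.E has_derivative (q2.E1 (T w) \<circ> T)) (at w)"
      by (rule has_derivative_transform_within_open[OF _ q1.open_\<Omega> that])
        (simp add: q1.E_def q2.E_def F)
    from has_derivative_unique[OF q1.E_der[OF that] this] show ?thesis by simp
  qed
  have E2: "q1.E2 w v z = q2.E2 (T w) (T v) (T z)" for v z
  proof -
    have "(((\<lambda>w. q2.E1 w (T v)) \<circ> T) has_derivative (q2.E2 (T w) (T v) \<circ> T)) (at w)"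
      by (rule diff_chain_at[OF T_der q2.E1_der[OF T_\<Omega>[OF w]]])
    then have "((\<lambda>w. q1.E1 w v) has_derivative (q2.E2 (T w) (T v) \<circ> T)) (at w)"
      by (rule has_derivative_transform_within_open[OF _ q1.open_\<Omega> w]) (simp add: E1)
    from has_derivative_unique[OF q1.E1_der[OF w] this] show ?thesis by simp
  qed
  have mT: "matrix T *v x = T x" for x using T(1) by (simp add: matrix_works)
  have "q1.g w = transpose (matrix T) ** q2.g (T w) ** matrix T"
  proof (rule matrix_eqI_inner)
    fix x y
    have "x \<bullet> ((transpose (matrix T) ** q2.g (T w) ** matrix T) *v y) = T x \<bullet> (q2.g (T w) *v T y)"
      by (simp only: matrix_vector_mul_assoc[symmetric] inner_transpose mT)
    then show "x \<bullet> (q1.g w *v y) = x \<bullet> ((transpose (matrix T) ** q2.g (T w) ** matrix T) *v y)"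
      by (simp add: q1.inner_g q2.inner_g E2)
  qed
  then have "sqrt (det (q1.g w)) = \<bar>det (matrix T)\<bar> * sqrt (det (q2.g (T w)))"
    by (simp add: det_mul real_sqrt_mult mult.commute mult.left_commute)
  moreover have "q2.K = T ` q1.K"
    unfolding q1.K_def q2.K_def T(2)[symmetric] using F by auto
  then have "measure lebesgue q2.K = \<bar>det (matrix T)\<bar> * measure lebesgue q1.K"
    using measure_linear_image_cart[OF T(1) q1.K_lmeasurable] by simp
  ultimately show ?thesis by (simp add: q1.\<tau>_def q2.\<tau>_def ac_simps)
qed

section \<open>Manifolds and tangent vectors in charts\<close>

lemma smooth_on_differentiable:
  assumes "smooth_on S f" "open S" "x \<in> S"
  shows "f differentiable at x"
proof -
  have "Ck_on (Suc 0) S f" using assms(1) unfolding smooth_on_def by blast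
  then show ?thesis using assms(2,3) by (simp add: differentiable_on_eq_differentiable_at)
qed

text \<open>A submersion has local sections. Let B be a linear right inverse of the derivative at
  u0. Precomposing h with the affine map \<psi> built from B makes the derivative at h u0 the
  identity, so the inverse function theorem gives a local inverse q of the composite, and \<psi>
  after q is the section.\<close>

lemma local_right_inverse:
  fixes h :: "'f::euclidean_space \<Rightarrow> 'e::euclidean_space"
  assumes "smooth_on U h" "open U" "u0 \<in> U" and surj: "surj (frechet_derivative h (at u0))"
  obtains V \<sigma> where "open V" "h u0 \<in> V" "\<sigma> (h u0) = u0" "\<And>v. v \<in> V \<Longrightarrow> \<sigma> v \<in> U \<and> h (\<sigma> v) = v"
    "\<sigma> differentiable at (h u0)" "continuous_on V \<sigma>"
proof -
  have "Ck_on (Suc 0) U h" using assms(1) unfolding smooth_on_def by blast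
  then have cont: "continuous_on U (\<lambda>u. frechet_derivative h (at u) i)" if "i \<in> Basis" for i
    using that by simp
  have der: "(h has_derivative frechet_derivative h (at u)) (at u)" if "u \<in> U" for u
    using smooth_on_differentiable[OF assms(1,2) that] frechet_derivative_works by blast
  have lin: "linear (frechet_derivative h (at u))" if "u \<in> U" for u
    using der[OF that] has_derivative_linear by blast
  obtain B where B: "linear B" "frechet_derivative h (at u0) \<circ> B = id"
    using linear_surjective_right_inverse[OF lin[OF assms(3)] surj] by blast
  define v0 where "v0 = h u0"
  define \<psi> where "\<psi> v = u0 + B (v - v0)" for v
  have blB: "bounded_linear B" using B(1) by (simp add: linear_conv_bounded_linear)
  have \<psi>_der: "(\<psi> has_derivative B) (at v)" for v
    unfolding \<psi>_def by (auto intro!: derivative_eq_intros bounded_linear.has_derivative[OF blB])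
  have \<psi>0: "\<psi> v0 = u0" by (simp add: \<psi>_def linear_0[OF B(1)])
  have \<psi>_cont: "continuous_on S \<psi>" for S
    using \<psi>_der by (meson continuous_at_imp_continuous_on has_derivative_continuous)
  define U' where "U' = \<psi> -` U"
  have "open U'" unfolding U'_def by (rule open_vimage[OF assms(2) \<psi>_cont])
  have "v0 \<in> U'" by (simp add: U'_def \<psi>0 assms(3))
  define k' where "k' v = Blinfun (\<lambda>x. frechet_derivative h (at (\<psi> v)) (B x))" for v
  have k': "blinfun_apply (k' v) = (\<lambda>x. frechet_derivative h (at (\<psi> v)) (B x))" if "v \<in> U'" for v
  proof -
    have "linear (\<lambda>x. frechet_derivative h (at (\<psi> v)) (B x))"
      using linear_compose[OF B(1) lin] that by (simp add: U'_def o_def)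
    then show ?thesis unfolding k'_def
      by (intro bounded_linear_Blinfun_apply) (simp add: linear_conv_bounded_linear)
  qed
  have k_der: "((h \<circ> \<psi>) has_derivative blinfun_apply (k' v)) (at v)" if "v \<in> U'" for v
    using diff_chain_at[OF \<psi>_der der] that k'[OF that] by (simp add: U'_def o_def)
  have k'_cont: "continuous_on U' k'"
  proof (rule continuous_on_blinfun_componentwise)
    fix i :: 'e assume "i \<in> Basis"
    \<comment> \<open>\<open>smooth_on\<close> yields continuity of the derivative at fixed basis
      vectors only, so \<open>B i\<close> is expanded in the basis.\<close>
    have "blinfun_apply (k' v) i = (\<Sum>j\<in>Basis. (B i \<bullet> j) *\<^sub>R frechet_derivative h (at (\<psi> v)) j)"
      if "v \<in> U'" for v
    proof -
      have l: "linear (frechet_derivative h (at (\<psi> v)))" using that lin by (simp add: U'_def)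
      have "frechet_derivative h (at (\<psi> v)) (B i)
          = frechet_derivative h (at (\<psi> v)) (\<Sum>j\<in>Basis. (B i \<bullet> j) *\<^sub>R j)"
        by (simp add: euclidean_representation)
      then show ?thesis by (simp add: k'[OF that] linear_sum[OF l] linear_scale[OF l])
    qed
    moreover have "continuous_on U' (\<lambda>v. \<Sum>j\<in>Basis. (B i \<bullet> j) *\<^sub>R frechet_derivative h (at (\<psi> v)) j)"
      by (intro continuous_intros continuous_on_compose2[OF cont \<psi>_cont]) (auto simp: U'_def)
    ultimately show "continuous_on U' (\<lambda>v. blinfun_apply (k' v) i)"
      by (simp cong: continuous_on_cong)
  qed
  have "blinfun_apply (k' v0) x = x" for x
    using B(2) by (simp add: k'[OF \<open>v0 \<in> U'\<close>] \<psi>0 fun_eq_iff)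
  then have "id_blinfun o\<^sub>L k' v0 = id_blinfun" by (intro blinfun_eqI) simp
  from inverse_function_theorem[OF \<open>open U'\<close> k_der k'_cont \<open>v0 \<in> U'\<close> this]
  obtain W V q q' where W: "open W" "W \<subseteq> U'" "v0 \<in> W" and V: "open V" "(h \<circ> \<psi>) v0 \<in> V"
    and hom: "homeomorphism W V (h \<circ> \<psi>) q" and q: "\<And>y. y \<in> V \<Longrightarrow> (q has_derivative q' y) (at y)"
    by metis
  have hv0: "(h \<circ> \<psi>) v0 = v0" unfolding o_def \<psi>0 by (simp add: v0_def)
  then have q0: "q v0 = v0" using hom W(3) unfolding homeomorphism_def by metis
  show thesis
  proof
    show "open V" "h u0 \<in> V" using V hv0 by (auto simp: v0_def)
    show "(\<psi> \<circ> q) (h u0) = u0" using q0 \<psi>0 by (simp add: v0_def)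
    show "(\<psi> \<circ> q) v \<in> U \<and> h ((\<psi> \<circ> q) v) = v" if "v \<in> V" for v
      using hom that W(2) unfolding homeomorphism_def U'_def by auto
    show "(\<psi> \<circ> q) differentiable at (h u0)"
      using diff_chain_at[OF q \<psi>_der, of v0] V(2) hv0 by (auto simp: differentiable_def v0_def)
    have "continuous_on V q"
      using q by (intro continuous_at_imp_continuous_on ballI has_derivative_continuous) blast
    then show "continuous_on V (\<psi> \<circ> q)" by (rule continuous_on_compose[OF _ \<psi>_cont])
  qed
qed

lemma charts_atD:
  assumes "c \<in> charts_at M p" shows "c \<in> charts M" "p \<in> fst c"
  using assms by (auto simp: charts_at_def)

locale manifold =
  fixes M :: "('p, 'e::euclidean_space) mfd"
  assumes M: "smooth_manifold M"
begin

lemma chart_openin: "c \<in> charts M \<Longrightarrow> openin (mtop M) (fst c)"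
  and chart_open_image: "c \<in> charts M \<Longrightarrow> open (snd c ` fst c)"
  and chart_homeomorphic: "c \<in> charts M \<Longrightarrow>
    homeomorphic_map (subtopology (mtop M) (fst c)) (top_of_set (snd c ` fst c)) (snd c)"
  using M unfolding smooth_manifold_def by auto

lemma chart_subset: "c \<in> charts M \<Longrightarrow> fst c \<subseteq> topspace (mtop M)"
  using chart_openin openin_subset by blast

lemma inj_chart: "c \<in> charts M \<Longrightarrow> inj_on (snd c) (fst c)"
  using chart_homeomorphic[of c] chart_subset[of c] homeomorphic_eq_everything_map[of "subtopology (mtop M) (fst c)"]
  by (auto simp: Int_absorb1)

lemma chart_inv_chart: "c \<in> charts M \<Longrightarrow> p \<in> fst c \<Longrightarrow> chart_inv c (snd c p) = p"
  unfolding chart_inv_def by (rule inv_into_f_f[OF inj_chart])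

lemma chart_chart_inv: "u \<in> snd c ` fst c \<Longrightarrow> snd c (chart_inv c u) = u"
  unfolding chart_inv_def by (rule f_inv_into_f)

lemma chart_inv_mem: "u \<in> snd c ` fst c \<Longrightarrow> chart_inv c u \<in> fst c"
  unfolding chart_inv_def by (rule inv_into_into)

lemma open_chart_image:
  assumes "c \<in> charts M" "openin (mtop M) W" "W \<subseteq> fst c"
  shows "open (snd c ` W)"
proof -
  have "open_map (subtopology (mtop M) (fst c)) (top_of_set (snd c ` fst c)) (snd c)"
    using chart_homeomorphic[OF assms(1)] homeomorphic_eq_everything_map by blast
  moreover have "openin (subtopology (mtop M) (fst c)) W"
    using assms(2,3) by (simp add: openin_subtopology_Int2 openin_subtopology inf.absorb1) (metis inf.absorb1)
  ultimately have "openin (top_of_set (snd c ` fst c)) (snd c ` W)" unfolding open_map_def by blast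
  then show ?thesis using chart_open_image[OF assms(1)] openin_open_trans by blast
qed

lemma charts_at_nonempty: "p \<in> topspace (mtop M) \<Longrightarrow> \<exists>c. c \<in> charts_at M p"
  using M unfolding smooth_manifold_def charts_at_def by blast

lemma charts_at_topspace: "c \<in> charts_at M p \<Longrightarrow> p \<in> topspace (mtop M)"
  by (rule subsetD[OF chart_subset[OF charts_atD(1)] charts_atD(2)])

lemma transition_differentiable:
  assumes "c \<in> charts_at M p" "c' \<in> charts_at M p"
  shows "(snd c' \<circ> chart_inv c) differentiable at (snd c p)"
proof (rule smooth_on_differentiable)
  note c = charts_atD[OF assms(1)] charts_atD[OF assms(2)]
  show "smooth_on (snd c ` (fst c \<inter> fst c')) (snd c' \<circ> chart_inv c)"
    using M c unfolding smooth_manifold_def by blast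
  show "open (snd c ` (fst c \<inter> fst c'))"
    using c by (intro open_chart_image openin_Int chart_openin) auto
  show "snd c p \<in> snd c ` (fst c \<inter> fst c')" using c by blast
qed

lemma transition_linear:
  assumes "c \<in> charts_at M p" "c' \<in> charts_at M p"
  shows "linear (frechet_derivative (snd c' \<circ> chart_inv c) (at (snd c p)))"
  by (rule linear_frechet_derivative[OF transition_differentiable[OF assms]])

lemma tvec_of_eq:
  assumes "c \<in> charts_at M p" "v \<in> tangent_space M p"
  shows "tvec_of M c p (v c) = v"
proof
  fix c'
  show "tvec_of M c p (v c) c' = v c'"
  proof (cases "c' \<in> charts_at M p")
    case True
    then have "v c' = frechet_derivative (snd c' \<circ> chart_inv c) (at (snd c p)) (v c)"
      using assms unfolding tangent_space_def by blast
    with True show ?thesis unfolding tvec_of_def by metis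
  next
    case False
    then have "v c' = 0" using assms unfolding tangent_space_def by blast
    with False show ?thesis unfolding tvec_of_def by metis
  qed
qed

text \<open>The transition from a chart to itself is the identity near the point. Together with
  \<open>tvec_of_eq\<close> and \<open>tvec_of_tangent\<close> this makes
  \<open>tvec_of M c p\<close> a bijection from the model space to the tangent space.\<close>

lemma tvec_of_self:
  assumes "c \<in> charts_at M p"
  shows "tvec_of M c p w c = w"
proof -
  note c = charts_atD[OF assms]
  have "((snd c \<circ> chart_inv c) has_derivative (\<lambda>x. x)) (at (snd c p))"
    by (rule has_derivative_transform_within_open[OF has_derivative_ident chart_open_image[OF c(1)]])
      (use c in \<open>auto simp: chart_inv_chart\<close>)
  from frechet_derivative_at[OF this] show ?thesis using assms by (simp add: tvec_of_def fun_eq_iff)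
qed

text \<open>By the chain rule the Jacobians of coordinate changes compose, which is the
  compatibility that \<open>tangent_space\<close> demands.\<close>

lemma tvec_of_tangent:
  assumes c: "c \<in> charts_at M p"
  shows "tvec_of M c p w \<in> tangent_space M p"
proof -
  have chain: "frechet_derivative (snd c2 \<circ> chart_inv c) (at (snd c p)) w
      = frechet_derivative (snd c2 \<circ> chart_inv c1) (at (snd c1 p))
          (frechet_derivative (snd c1 \<circ> chart_inv c) (at (snd c p)) w)"
    if c1: "c1 \<in> charts_at M p" and c2: "c2 \<in> charts_at M p" for c1 c2
  proof -
    note C = charts_atD[OF c] charts_atD[OF c1] charts_atD[OF c2]
    let ?t = "\<lambda>c c'. frechet_derivative (snd c' \<circ> chart_inv c) (at (snd c p))"
    have d1: "((snd c1 \<circ> chart_inv c) has_derivative ?t c c1) (at (snd c p))"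
      by (rule frechet_derivative_works[THEN iffD1, OF transition_differentiable[OF c c1]])
    have "((snd c2 \<circ> chart_inv c1) has_derivative ?t c1 c2) (at ((snd c1 \<circ> chart_inv c) (snd c p)))"
      using frechet_derivative_works[THEN iffD1, OF transition_differentiable[OF c1 c2]] C
      by (simp add: chart_inv_chart)
    from diff_chain_at[OF d1 this]
    have "((snd c2 \<circ> chart_inv c) has_derivative (?t c1 c2 \<circ> ?t c c1)) (at (snd c p))"
    proof (rule has_derivative_transform_within_open)
      show "open (snd c ` (fst c \<inter> fst c1))"
        using C by (intro open_chart_image openin_Int chart_openin) auto
    qed (use C in \<open>auto simp: chart_inv_chart\<close>)
    from frechet_derivative_at[OF this] show ?thesis by (simp add: fun_eq_iff)
  qed
  show ?thesis unfolding tangent_space_def tvec_of_def mem_Collect_eq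
    by (intro conjI ballI allI impI) (simp_all only: if_True if_False chain[symmetric])
qed

lemma tvec_of_add:
  assumes "c \<in> charts_at M p"
  shows "tvec_of M c p (v + w) = tv_add (tvec_of M c p v) (tvec_of M c p w)"
  unfolding tvec_of_def tv_add_def
  by (rule ext) (simp add: linear_add[OF transition_linear[OF assms]])

lemma tvec_of_scale:
  assumes "c \<in> charts_at M p"
  shows "tvec_of M c p (r *\<^sub>R v) = tv_scale r (tvec_of M c p v)"
  unfolding tvec_of_def tv_scale_def
  by (rule ext) (simp add: linear_scale[OF transition_linear[OF assms]])

lemma tvec_of_eq_zero:
  assumes "c \<in> charts_at M p"
  shows "tvec_of M c p v = tv_zero \<longleftrightarrow> v = 0"
proof
  assume "tvec_of M c p v = tv_zero"
  then show "v = 0" using tvec_of_self[OF assms, of v] by (simp add: tv_zero_def)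
next
  assume "v = 0"
  then show "tvec_of M c p v = tv_zero" using tvec_of_scale[OF assms, of 0 0] by (simp add: tv_scale_def tv_zero_def)
qed

end

lemma smooth_map_differentiable:
  assumes M: "smooth_manifold M" and N: "smooth_manifold N" and f: "smooth_map M N f"
    and c: "c \<in> charts_at M p" and c': "c' \<in> charts_at N (f p)"
  shows "open (snd c ` {p \<in> fst c. f p \<in> fst c'})"
    and "smooth_on (snd c ` {p \<in> fst c. f p \<in> fst c'}) (snd c' \<circ> f \<circ> chart_inv c)"
    and "(snd c' \<circ> f \<circ> chart_inv c) differentiable at (snd c p)"
proof -
  interpret M: manifold M by unfold_locales (rule M)
  interpret N: manifold N by unfold_locales (rule N)
  note C = charts_atD[OF c] charts_atD[OF c']
  have "openin (mtop M) {p \<in> topspace (mtop M). f p \<in> fst c'}"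
    using f N.chart_openin[OF C(3)] unfolding smooth_map_def
    by (intro openin_continuous_map_preimage) auto
  then have "openin (mtop M) (fst c \<inter> {p \<in> topspace (mtop M). f p \<in> fst c'})"
    using M.chart_openin[OF C(1)] by blast
  moreover have "fst c \<inter> {p \<in> topspace (mtop M). f p \<in> fst c'} = {p \<in> fst c. f p \<in> fst c'}"
    using M.chart_subset[OF C(1)] by blast
  ultimately show *: "open (snd c ` {p \<in> fst c. f p \<in> fst c'})"
    using M.open_chart_image[OF C(1)] by auto
  show **: "smooth_on (snd c ` {p \<in> fst c. f p \<in> fst c'}) (snd c' \<circ> f \<circ> chart_inv c)"
    using f C unfolding smooth_map_def by blast
  show "(snd c' \<circ> f \<circ> chart_inv c) differentiable at (snd c p)"
    by (rule smooth_on_differentiable[OF ** *]) (use C in auto)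
qed

lemma chart_inv_prod:
  assumes L: "smooth_manifold L" and "c \<in> charts L" "d \<in> charts L" "p \<in> fst c" "q \<in> fst d"
  shows "chart_inv (fst c \<times> fst d, map_prod (snd c) (snd d)) (snd c p, snd d q) = (p, q)"
proof -
  interpret manifold L by unfold_locales (rule L)
  have "inj_on (map_prod (snd c) (snd d)) (fst c \<times> fst d)"
    using assms inj_chart by (intro map_prod_inj_on)
  from inv_into_f_f[OF this, of "(p, q)"] show ?thesis using assms by (simp add: chart_inv_def)
qed

locale lie =
  fixes G :: "('g, 'x) monoid_scheme" and L :: "('g, 'f::euclidean_space) mfd"
  assumes lie: "lie_group G L"
begin

sublocale group G using lie by (simp add: lie_group_def)
sublocale L: manifold L using lie by unfold_locales (simp add: lie_group_def)

lemma topspace_L: "topspace (mtop L) = carrier G" using lie by (simp add: lie_group_def)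

text \<open>In charts, left translation by g is the multiplication after the affine map that fixes
  the first coordinate at \<open>snd c g\<close>.\<close>

lemma left_translation_differentiable:
  assumes g: "g \<in> carrier G" and d: "d \<in> charts_at L x" and d': "d' \<in> charts_at L (g \<otimes>\<^bsub>G\<^esub> x)"
  shows "(snd d' \<circ> (\<lambda>y. g \<otimes>\<^bsub>G\<^esub> y) \<circ> chart_inv d) differentiable at (snd d x)"
proof -
  let ?mult = "\<lambda>(a, b). a \<otimes>\<^bsub>G\<^esub> b"
  obtain c where c: "c \<in> charts_at L g" using g topspace_L L.charts_at_nonempty by blast
  note C = charts_atD[OF c] charts_atD[OF d] charts_atD[OF d']
  define P where "P = (fst c \<times> fst d, map_prod (snd c) (snd d))"
  let ?W = "{p \<in> fst c \<times> fst d. ?mult p \<in> fst d'}"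
  have "\<exists>c d. P = (fst c \<times> fst d, map_prod (snd c) (snd d)) \<and> c \<in> charts L \<and> d \<in> charts L"
    using C(1,3) unfolding P_def by blast
  then have P: "P \<in> charts (prod_mfd L L)"
    unfolding prod_mfd_def mfd.select_convs mem_Collect_eq .
  have mult: "smooth_map (prod_mfd L L) L ?mult" using lie by (simp add: lie_group_def)
  have cont: "continuous_map (prod_topology (mtop L) (mtop L)) (mtop L) ?mult"
    using mult by (simp add: smooth_map_def prod_mfd_def)
  have smooth: "smooth_on (map_prod (snd c) (snd d) ` ?W) (snd d' \<circ> ?mult \<circ> chart_inv P)"
    using mult P C(5) unfolding smooth_map_def by (force simp: P_def)
  have inv: "chart_inv P (snd c a, snd d b) = (a, b)" if "a \<in> fst c" "b \<in> fst d" for a b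
    using chart_inv_prod[OF L.M C(1,3) that] by (simp add: P_def)
  \<comment> \<open>\<open>smooth_on\<close> gives derivatives on open sets. Openness of this
    coordinate image is checked with boxes from the product topology, mapped by the two charts
    separately.\<close>
  have "open (map_prod (snd c) (snd d) ` ?W)"
    unfolding open_prod_def
  proof (intro ballI)
    fix z assume "z \<in> map_prod (snd c) (snd d) ` ?W"
    then obtain a b where ab: "z = (snd c a, snd d b)" "a \<in> fst c" "b \<in> fst d" "a \<otimes>\<^bsub>G\<^esub> b \<in> fst d'"
      by auto
    have op: "openin (prod_topology (mtop L) (mtop L))
        {p \<in> topspace (prod_topology (mtop L) (mtop L)). ?mult p \<in> fst d'}"
      by (rule openin_continuous_map_preimage[OF cont L.chart_openin[OF C(5)]])
    have mem: "(a, b) \<in> {p \<in> topspace (prod_topology (mtop L) (mtop L)). ?mult p \<in> fst d'}"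
      using ab L.chart_subset[OF C(1)] L.chart_subset[OF C(3)] by auto
    obtain A B where AB: "openin (mtop L) A" "openin (mtop L) B" "a \<in> A" "b \<in> B"
      "A \<times> B \<subseteq> {p \<in> topspace (prod_topology (mtop L) (mtop L)). ?mult p \<in> fst d'}"
      using op[unfolded openin_prod_topology_alt, rule_format, OF mem] by (elim exE conjE) (rule that)
    have "open (snd c ` (fst c \<inter> A))" "open (snd d ` (fst d \<inter> B))"
      using AB C by (intro L.open_chart_image openin_Int L.chart_openin; auto)+
    moreover have "z \<in> (snd c ` (fst c \<inter> A)) \<times> (snd d ` (fst d \<inter> B))" using ab AB by auto
    moreover have "(snd c ` (fst c \<inter> A)) \<times> (snd d ` (fst d \<inter> B)) \<subseteq> map_prod (snd c) (snd d) ` ?W"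
    proof
      fix y assume "y \<in> (snd c ` (fst c \<inter> A)) \<times> (snd d ` (fst d \<inter> B))"
      then obtain a' b' where y: "y = map_prod (snd c) (snd d) (a', b')" "a' \<in> fst c \<inter> A" "b' \<in> fst d \<inter> B"
        by auto
      then have "(a', b') \<in> ?W" using AB(5) by blast
      with y(1) show "y \<in> map_prod (snd c) (snd d) ` ?W" by blast
    qed
    ultimately show "\<exists>A B. open A \<and> open B \<and> z \<in> A \<times> B \<and> A \<times> B \<subseteq> map_prod (snd c) (snd d) ` ?W"
      by blast
  qed
  moreover have "(snd c g, snd d x) \<in> map_prod (snd c) (snd d) ` ?W"
    using C by (intro image_eqI[of _ _ "(g, x)"]) auto
  ultimately have "(snd d' \<circ> ?mult \<circ> chart_inv P) differentiable at (snd c g, snd d x)"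
    by (rule smooth_on_differentiable[OF smooth])
  moreover have "(\<lambda>u. (snd c g, u)) differentiable at (snd d x)"
    by (auto simp: differentiable_def intro!: derivative_eq_intros exI)
  ultimately have "((snd d' \<circ> ?mult \<circ> chart_inv P) \<circ> (\<lambda>u. (snd c g, u))) differentiable at (snd d x)"
    by (intro differentiable_chain_at)
  then obtain D where "(((snd d' \<circ> ?mult \<circ> chart_inv P) \<circ> (\<lambda>u. (snd c g, u))) has_derivative D) (at (snd d x))"
    by (auto simp: differentiable_def)
  then have "((snd d' \<circ> (\<lambda>y. g \<otimes>\<^bsub>G\<^esub> y) \<circ> chart_inv d) has_derivative D) (at (snd d x))"
    by (rule has_derivative_transform_within_open[OF _ L.chart_open_image[OF C(3)]])
      (use C in \<open>auto simp: inv L.chart_inv_chart\<close>)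
  then show ?thesis by (auto simp: differentiable_def)
qed

lemma left_translation_continuous:
  assumes g: "g \<in> carrier G"
  shows "continuous_map (mtop L) (mtop L) (\<lambda>y. g \<otimes>\<^bsub>G\<^esub> y)"
proof -
  have "continuous_map (prod_topology (mtop L) (mtop L)) (mtop L) (\<lambda>(a, b). a \<otimes>\<^bsub>G\<^esub> b)"
    using lie by (simp add: lie_group_def smooth_map_def prod_mfd_def)
  moreover have "continuous_map (mtop L) (prod_topology (mtop L) (mtop L)) (\<lambda>y. (g, y))"
    using g by (intro continuous_map_pairedI) (auto simp: topspace_L)
  ultimately have "continuous_map (mtop L) (mtop L) ((\<lambda>(a, b). a \<otimes>\<^bsub>G\<^esub> b) \<circ> (\<lambda>y. (g, y)))"
    by (intro continuous_map_compose)
  then show ?thesis by (simp add: o_def)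
qed

end

section \<open>Left translations of a homogeneous space\<close>

locale homogeneous = lie G L
  for G :: "('g, 'x) monoid_scheme" and L :: "('g, 'f::euclidean_space) mfd" +
  fixes H :: "'g set" and M :: "('g set, 'e::euclidean_space) mfd"
  assumes H: "subgroup H G" and hom: "homogeneous_space G L H M"
begin

sublocale M: manifold M using hom by unfold_locales (simp add: homogeneous_space_def)

lemma topspace_M: "topspace (mtop M) = (\<lambda>x. x <#\<^bsub>G\<^esub> H) ` carrier G"
  using hom by (auto simp: homogeneous_space_def LCOSETS_def)

lemma translate_coset:
  "g \<in> carrier G \<Longrightarrow> x \<in> carrier G \<Longrightarrow> g <#\<^bsub>G\<^esub> (x <#\<^bsub>G\<^esub> H) = (g \<otimes>\<^bsub>G\<^esub> x) <#\<^bsub>G\<^esub> H"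
  by (rule lcos_m_assoc[OF subgroup.subset[OF H]])

lemma translate_inv:
  assumes "g \<in> carrier G" "p \<in> topspace (mtop M)"
  shows "inv\<^bsub>G\<^esub> g <#\<^bsub>G\<^esub> (g <#\<^bsub>G\<^esub> p) = p"
  using assms unfolding topspace_M by (auto simp: translate_coset m_assoc[symmetric])

lemma transitive:
  assumes "p \<in> topspace (mtop M)" "q \<in> topspace (mtop M)"
  obtains g where "g \<in> carrier G" "g <#\<^bsub>G\<^esub> p = q"
proof -
  from assms obtain x y where xy: "x \<in> carrier G" "y \<in> carrier G" "p = x <#\<^bsub>G\<^esub> H" "q = y <#\<^bsub>G\<^esub> H"
    unfolding topspace_M by blast
  show thesis
    by (rule that[of "y \<otimes>\<^bsub>G\<^esub> inv\<^bsub>G\<^esub> x"]) (use xy in \<open>simp_all add: translate_coset m_assoc\<close>)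
qed

text \<open>Near p, the translation of G/H by g is a local section of the projection, followed by
  left translation in G, followed by the projection. All three are differentiable in charts. The
  neighbourhood in the second claim is what derivatives of composites are later localised
  to.\<close>

lemma translation_in_charts:
  assumes g: "g \<in> carrier G" and c: "c \<in> charts_at M p" and c': "c' \<in> charts_at M (g <#\<^bsub>G\<^esub> p)"
  shows translation_differentiable:
      "(snd c' \<circ> (\<lambda>p. g <#\<^bsub>G\<^esub> p) \<circ> chart_inv c) differentiable at (snd c p)" (is ?diff)
    and translation_local: "\<exists>V. open V \<and> snd c p \<in> V \<and> V \<subseteq> snd c ` fst c
      \<and> (\<forall>v\<in>V. g <#\<^bsub>G\<^esub> chart_inv c v \<in> fst c')" (is ?loc)
proof -
  let ?\<pi> = "\<lambda>a. a <#\<^bsub>G\<^esub> H"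
  obtain x where x: "x \<in> carrier G" "p = ?\<pi> x"
    using M.charts_at_topspace[OF c] unfolding topspace_M by blast
  \<comment> \<open>Exactly this chart is used by \<open>differential\<close> at x, so the
    submersion condition becomes surjectivity of the derivative of h.\<close>
  define d where "d = (SOME d. d \<in> charts_at L x)"
  have d: "d \<in> charts_at L x"
    unfolding d_def by (rule someI_ex[OF L.charts_at_nonempty]) (use x(1) topspace_L in simp)
  have gx: "g \<otimes>\<^bsub>G\<^esub> x \<in> carrier G" using g x by simp
  then obtain d' where d': "d' \<in> charts_at L (g \<otimes>\<^bsub>G\<^esub> x)" using L.charts_at_nonempty topspace_L by blast
  note C = charts_atD[OF c] charts_atD[OF c'] charts_atD[OF d] charts_atD[OF d']
  have \<pi>: "smooth_map L M ?\<pi>" using hom by (simp add: homogeneous_space_def)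
  have c_x: "c \<in> charts_at M (?\<pi> x)" using c x(2) by simp
  have c'_gx: "c' \<in> charts_at M (?\<pi> (g \<otimes>\<^bsub>G\<^esub> x))" using c' translate_coset[OF g x(1)] x(2) by simp
  define h where "h = snd c \<circ> ?\<pi> \<circ> chart_inv d"
  define U where "U = snd d ` {a \<in> fst d. ?\<pi> a \<in> fst c}"
  have U: "open U" "smooth_on U h"
    using smooth_map_differentiable[OF L.M M.M \<pi> d c_x] by (simp_all add: U_def h_def)
  have u0: "snd d x \<in> U" using C x by (auto simp: U_def)
  have h0: "h (snd d x) = snd c p" using C x by (simp add: h_def L.chart_inv_chart)
  have surj: "surj (frechet_derivative h (at (snd d x)))"
    unfolding surj_def
  proof
    fix w
    have "tvec_of M c p w \<in> differential L M ?\<pi> x ` tangent_space L x"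
      using hom x M.tvec_of_tangent[OF c] by (simp add: homogeneous_space_def)
    then obtain v where "tvec_of M c p w = differential L M ?\<pi> x v" by blast
    then have "tvec_of M c p w c = differential L M ?\<pi> x v c" by simp
    then have "w = frechet_derivative h (at (snd d x)) (v d)"
      using c_x unfolding M.tvec_of_self[OF c] by (simp add: differential_def Let_def h_def d_def)
    then show "\<exists>z. w = frechet_derivative h (at (snd d x)) z" by blast
  qed
  obtain V0 \<sigma> where V0: "open V0" "snd c p \<in> V0" and \<sigma>0: "\<sigma> (snd c p) = snd d x"
    and \<sigma>: "\<And>v. v \<in> V0 \<Longrightarrow> \<sigma> v \<in> U \<and> h (\<sigma> v) = v"
    and \<sigma>_diff: "\<sigma> differentiable at (snd c p)" and \<sigma>_cont: "continuous_on V0 \<sigma>"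
    using local_right_inverse[OF U(2,1) u0 surj] unfolding h0 by metis
  \<comment> \<open>Points of the chart d whose translates lie in d' and project into c'.
    Restricting the section to values in W makes all coordinate expressions below
    meaningful.\<close>
  define W where "W = {a \<in> fst d. g \<otimes>\<^bsub>G\<^esub> a \<in> fst d' \<and> ?\<pi> (g \<otimes>\<^bsub>G\<^esub> a) \<in> fst c'}"
  have "openin (mtop L) (fst d \<inter> {a \<in> topspace (mtop L). g \<otimes>\<^bsub>G\<^esub> a \<in> fst d'}
      \<inter> {a \<in> topspace (mtop L). (?\<pi> \<circ> (\<lambda>a. g \<otimes>\<^bsub>G\<^esub> a)) a \<in> fst c'})"
    using \<pi> unfolding smooth_map_def
    by (intro openin_Int L.chart_openin[OF C(5)]
        openin_continuous_map_preimage[OF left_translation_continuous[OF g] L.chart_openin[OF C(7)]]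
        openin_continuous_map_preimage[OF
          continuous_map_compose[OF left_translation_continuous[OF g]] M.chart_openin[OF C(3)]])
      (rule conjunct1)
  moreover have "fst d \<inter> {a \<in> topspace (mtop L). g \<otimes>\<^bsub>G\<^esub> a \<in> fst d'}
      \<inter> {a \<in> topspace (mtop L). (?\<pi> \<circ> (\<lambda>a. g \<otimes>\<^bsub>G\<^esub> a)) a \<in> fst c'} = W"
    using L.chart_subset[OF C(5)] by (auto simp: W_def)
  ultimately have openW: "open (snd d ` W)"
    by (intro L.open_chart_image[OF C(5)]) (auto simp: W_def)
  define V where "V = V0 \<inter> \<sigma> -` (snd d ` W)"
  have "open V"
    unfolding V_def by (rule continuous_open_preimage[OF \<sigma>_cont V0(1) openW])
  have "x \<in> W" using C c'_gx by (auto simp: W_def dest: charts_atD)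
  then have p_V: "snd c p \<in> V" using V0(2) \<sigma>0 by (simp add: V_def)
  have key: "\<exists>a\<in>W. a \<in> carrier G \<and> chart_inv d (\<sigma> v) = a \<and> chart_inv c v = ?\<pi> a \<and> v \<in> snd c ` fst c"
    if v: "v \<in> V" for v
  proof -
    obtain a where a: "a \<in> W" "\<sigma> v = snd d a" using v by (auto simp: V_def)
    have "a \<in> fst d" using a by (simp add: W_def)
    then have inv: "chart_inv d (\<sigma> v) = a" using a C by (simp add: L.chart_inv_chart)
    have "\<sigma> v \<in> U" "h (\<sigma> v) = v" using v \<sigma> by (auto simp: V_def)
    then obtain a' where a': "a' \<in> fst d" "?\<pi> a' \<in> fst c" "\<sigma> v = snd d a'" by (auto simp: U_def)
    then have "a' = a" using inv C by (simp add: L.chart_inv_chart)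
    have "snd c (?\<pi> a) = v" using \<open>h (\<sigma> v) = v\<close> inv by (simp add: h_def)
    then have "chart_inv c v = ?\<pi> a" "v \<in> snd c ` fst c"
      using a' C unfolding \<open>a' = a\<close> by (auto simp: M.chart_inv_chart)
    moreover have "a \<in> carrier G" using \<open>a \<in> fst d\<close> L.chart_subset[OF C(5)] topspace_L by blast
    ultimately show ?thesis using a inv by blast
  qed
  show ?loc
  proof (intro exI[of _ V] conjI ballI \<open>open V\<close> p_V subsetI)
    fix v assume "v \<in> V"
    from key[OF this] obtain a where a: "a \<in> W" "a \<in> carrier G" "chart_inv c v = ?\<pi> a" "v \<in> snd c ` fst c"
      by blast
    show "v \<in> snd c ` fst c" by (rule a)
    show "g <#\<^bsub>G\<^esub> chart_inv c v \<in> fst c'"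
      unfolding a(3) translate_coset[OF g a(2)] using a(1) by (simp add: W_def)
  qed
  let ?k = "snd d' \<circ> (\<lambda>a. g \<otimes>\<^bsub>G\<^esub> a) \<circ> chart_inv d"
  have "?k differentiable at (\<sigma> (snd c p))"
    unfolding \<sigma>0 by (rule left_translation_differentiable[OF g d d'])
  with \<sigma>_diff have "(?k \<circ> \<sigma>) differentiable at (snd c p)" by (rule differentiable_chain_at)
  moreover have "(?k \<circ> \<sigma>) (snd c p) = snd d' (g \<otimes>\<^bsub>G\<^esub> x)"
    using C by (simp add: \<sigma>0 L.chart_inv_chart)
  then have "(snd c' \<circ> ?\<pi> \<circ> chart_inv d') differentiable at ((?k \<circ> \<sigma>) (snd c p))"
    using smooth_map_differentiable(3)[OF L.M M.M \<pi> d' c'_gx] by simp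
  ultimately have "((snd c' \<circ> ?\<pi> \<circ> chart_inv d') \<circ> (?k \<circ> \<sigma>)) differentiable at (snd c p)"
    by (rule differentiable_chain_at)
  then obtain D where "(((snd c' \<circ> ?\<pi> \<circ> chart_inv d') \<circ> (?k \<circ> \<sigma>)) has_derivative D) (at (snd c p))"
    unfolding differentiable_def by blast
  then have "((snd c' \<circ> (\<lambda>p. g <#\<^bsub>G\<^esub> p) \<circ> chart_inv c) has_derivative D) (at (snd c p))"
  proof (rule has_derivative_transform_within_open[OF _ \<open>open V\<close> p_V])
    fix v assume "v \<in> V"
    from key[OF this] obtain a where a: "a \<in> W" "a \<in> carrier G" "chart_inv d (\<sigma> v) = a" "chart_inv c v = ?\<pi> a"
      by blast
    then show "((snd c' \<circ> ?\<pi> \<circ> chart_inv d') \<circ> (?k \<circ> \<sigma>)) v = (snd c' \<circ> (\<lambda>p. g <#\<^bsub>G\<^esub> p) \<circ> chart_inv c) v"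
      using C by (simp add: translate_coset[OF g] L.chart_inv_chart W_def)
  qed
  then show ?diff unfolding differentiable_def by blast
qed

definition D_translation ::
  "'g \<Rightarrow> ('g set, 'e) chart \<Rightarrow> ('g set, 'e) chart \<Rightarrow> 'g set \<Rightarrow> 'e \<Rightarrow> 'e" where
  "D_translation g c c' p = frechet_derivative (snd c' \<circ> (\<lambda>p. g <#\<^bsub>G\<^esub> p) \<circ> chart_inv c) (at (snd c p))"

lemma linear_D_translation:
  assumes "g \<in> carrier G" "c \<in> charts_at M p" "c' \<in> charts_at M (g <#\<^bsub>G\<^esub> p)"
  shows "linear (D_translation g c c' p)"
  unfolding D_translation_def by (rule linear_frechet_derivative[OF translation_differentiable[OF assms]])

text \<open>The chain rule for the composite of the translations by g and its inverse, which is the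
  identity near p. It later shows that the differential maps cone onto cone.\<close>

lemma D_translation_inv:
  assumes g: "g \<in> carrier G" and c: "c \<in> charts_at M p" and c': "c' \<in> charts_at M (g <#\<^bsub>G\<^esub> p)"
  shows "D_translation (inv\<^bsub>G\<^esub> g) c' c (g <#\<^bsub>G\<^esub> p) (D_translation g c c' p w) = w"
proof -
  note C = charts_atD[OF c] charts_atD[OF c']
  have p: "p \<in> topspace (mtop M)" by (rule M.charts_at_topspace[OF c])
  have c2: "c \<in> charts_at M (inv\<^bsub>G\<^esub> g <#\<^bsub>G\<^esub> (g <#\<^bsub>G\<^esub> p))" using c translate_inv[OF g p] by simp
  let ?f = "snd c' \<circ> (\<lambda>p. g <#\<^bsub>G\<^esub> p) \<circ> chart_inv c"
  let ?f' = "snd c \<circ> (\<lambda>p. inv\<^bsub>G\<^esub> g <#\<^bsub>G\<^esub> p) \<circ> chart_inv c'"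
  obtain V where V: "open V" "snd c p \<in> V" "V \<subseteq> snd c ` fst c"
    "\<And>v. v \<in> V \<Longrightarrow> g <#\<^bsub>G\<^esub> chart_inv c v \<in> fst c'"
    using translation_local[OF g c c'] by blast
  have "(?f has_derivative D_translation g c c' p) (at (snd c p))"
    unfolding D_translation_def
    by (rule frechet_derivative_works[THEN iffD1, OF translation_differentiable[OF g c c']])
  moreover have "(?f' has_derivative D_translation (inv\<^bsub>G\<^esub> g) c' c (g <#\<^bsub>G\<^esub> p)) (at (?f (snd c p)))"
    unfolding D_translation_def
    using frechet_derivative_works[THEN iffD1, OF translation_differentiable[OF _ c' c2]] g C
    by (simp add: M.chart_inv_chart)
  ultimately have "((?f' \<circ> ?f) has_derivative
      (D_translation (inv\<^bsub>G\<^esub> g) c' c (g <#\<^bsub>G\<^esub> p) \<circ> D_translation g c c' p)) (at (snd c p))"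
    by (rule diff_chain_at)
  then have "((\<lambda>v. v) has_derivative
      (D_translation (inv\<^bsub>G\<^esub> g) c' c (g <#\<^bsub>G\<^esub> p) \<circ> D_translation g c c' p)) (at (snd c p))"
  proof (rule has_derivative_transform_within_open[OF _ V(1,2)])
    fix v assume v: "v \<in> V"
    have v': "v \<in> snd c ` fst c" using v V(3) by (rule subsetD[rotated])
    have "chart_inv c v \<in> topspace (mtop M)"
      by (rule subsetD[OF M.chart_subset[OF C(1)] M.chart_inv_mem[OF v']])
    from translate_inv[OF g this] show "(?f' \<circ> ?f) v = v"
      unfolding o_apply M.chart_inv_chart[OF C(3) V(4)[OF v]] by (simp add: M.chart_chart_inv[OF v'])
  qed
  from has_derivative_unique[OF this has_derivative_ident] show ?thesis by (simp add: fun_eq_iff)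
qed

text \<open>The source chart is the one that \<open>differential\<close> selects; the target chart
  is free.\<close>

lemma differential_translation:
  assumes c: "c = (SOME c. c \<in> charts_at M p)" and c': "c' \<in> charts_at M (g <#\<^bsub>G\<^esub> p)"
  shows "differential M M (\<lambda>p. g <#\<^bsub>G\<^esub> p) p y c' = D_translation g c c' p (y c)"
  unfolding differential_def D_translation_def Let_def c using c' by (simp only: if_True)

end

section \<open>Distortion and S-curvature of the infinite series metric\<close>

text \<open>\<open>distortion\<close> and \<open>differential\<close> select their chart by this
  same term, so with it both can be unfolded in matching coordinates.\<close>

abbreviation some_chart :: "('p, 'e) mfd \<Rightarrow> 'p \<Rightarrow> ('p, 'e) chart" where
  "some_chart M p \<equiv> (SOME c. c \<in> charts_at M p)"

lemma (in manifold) some_chart: "p \<in> topspace (mtop M) \<Longrightarrow> some_chart M p \<in> charts_at M p"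
  by (rule someI_ex[OF charts_at_nonempty])

definition chart_metric where
  "chart_metric M a c p v w = a p (tvec_of M c p v) (tvec_of M c p w)"

definition chart_form where
  "chart_form M \<beta> c p w = \<beta> p (tvec_of M c p w)"

locale infinite_series = manifold M
  for M :: "('p, real^'n) mfd" +
  fixes a :: "'p \<Rightarrow> ('p, real^'n) tvec \<Rightarrow> ('p, real^'n) tvec \<Rightarrow> real"
    and \<beta> :: "'p \<Rightarrow> ('p, real^'n) tvec \<Rightarrow> real"
  assumes a: "riemannian_metric M a" and \<beta>: "one_form M \<beta>"
begin

abbreviation "F \<equiv> infinite_series_metric a \<beta>"
abbreviation "D \<equiv> infinite_series_domain M a \<beta>"
abbreviation "\<Omega> c p \<equiv> quadratic_linear.\<Omega> (chart_metric M a c p) (chart_form M \<beta> c p)"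

lemma quadratic_linear_chart:
  assumes c: "c \<in> charts_at M p"
  shows "quadratic_linear (chart_metric M a c p) (chart_form M \<beta> c p)"
proof (rule quadratic_linear.intro)
  have p: "p \<in> topspace (mtop M)" by (rule charts_at_topspace[OF c])
  note t = tvec_of_tangent[OF c]
  have lin: "linear_on_tangent M p (a p v)" if "v \<in> tangent_space M p" for v
    using a p that unfolding riemannian_metric_def by blast
  have sym: "a p v w = a p w v" if "v \<in> tangent_space M p" "w \<in> tangent_space M p" for v w
    using a p that unfolding riemannian_metric_def by blast
  have lin_\<beta>: "linear_on_tangent M p (\<beta> p)" using \<beta> p unfolding one_form_def by blast
  show sym': "chart_metric M a c p v w = chart_metric M a c p w v" for v w
    unfolding chart_metric_def by (rule sym[OF t t])
  have lin': "linear (chart_metric M a c p v)" for v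
    using lin[OF t, of v] t unfolding linear_on_tangent_def
    by (intro linearI) (simp_all add: chart_metric_def tvec_of_add[OF c] tvec_of_scale[OF c])
  moreover have "(\<lambda>v. chart_metric M a c p v w) = chart_metric M a c p w" for w
    by (rule ext) (rule sym')
  ultimately show "bilinear (chart_metric M a c p)" unfolding bilinear_def by simp
  show "0 < chart_metric M a c p v v" if "v \<noteq> 0" for v
    using a p t that tvec_of_eq_zero[OF c] unfolding riemannian_metric_def chart_metric_def by blast
  show "linear (chart_form M \<beta> c p)"
    using lin_\<beta> t unfolding linear_on_tangent_def
    by (intro linearI) (simp_all add: chart_form_def tvec_of_add[OF c] tvec_of_scale[OF c])
qed

lemma domain_iff:
  assumes c: "c \<in> charts_at M p"
  shows "(p, tvec_of M c p w) \<in> D \<longleftrightarrow> w \<in> \<Omega> c p"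
proof -
  interpret q: quadratic_linear "chart_metric M a c p" "chart_form M \<beta> c p"
    by (rule quadratic_linear_chart[OF c])
  show ?thesis
    using charts_at_topspace[OF c] tvec_of_tangent[OF c, of w] tvec_of_eq_zero[OF c, of w]
    by (auto simp: infinite_series_domain_def slit_tangent_bundle_def q.\<Omega>_def q.N_def
        riemannian_norm_def chart_metric_def chart_form_def)
qed

lemma metric_chart:
  assumes c: "c \<in> charts_at M p"
  shows "F p (tvec_of M c p w) = (chart_form M \<beta> c p w)\<^sup>2 /
    (chart_form M \<beta> c p w - quadratic_linear.N (chart_metric M a c p) w)"
  unfolding quadratic_linear.N_def[OF quadratic_linear_chart[OF c]]
  by (simp add: infinite_series_metric_def riemannian_norm_def chart_metric_def chart_form_def)

text \<open>The fundamental tensor differentiates in the fibre direction only, so in the chart at p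
  it is the matrix \<open>g\<close> of the forms at p, and the unit set in the volume ratio is
  \<open>K\<close>.\<close>

lemma distortion_chart:
  assumes py: "(p, y) \<in> D"
  shows "distortion M D F p y = quadratic_linear.\<tau> (chart_metric M a (some_chart M p) p)
    (chart_form M \<beta> (some_chart M p) p) (y (some_chart M p))"
proof -
  define c where "c = some_chart M p"
  have y: "p \<in> topspace (mtop M)" "y \<in> tangent_space M p"
    using py by (auto simp: infinite_series_domain_def slit_tangent_bundle_def)
  have c: "c \<in> charts_at M p" unfolding c_def by (rule some_chart[OF y(1)])
  interpret q: quadratic_linear "chart_metric M a c p" "chart_form M \<beta> c p"
    by (rule quadratic_linear_chart[OF c])
  have "y c \<in> q.\<Omega>" using py domain_iff[OF c, of "y c"] tvec_of_eq[OF c y(2)] by simp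
  moreover have "(local_fun M F c (snd c p) w)\<^sup>2 = q.E w" for w
    using charts_atD[OF c] by (simp add: local_fun_def chart_inv_chart metric_chart[OF c] q.E_def)
  ultimately have "fundamental_tensor (local_fun M F c) (snd c p) (y c) = q.g (y c)"
    by (intro q.fundamental_tensor_eq_g)
  moreover have "{w. (p, tvec_of M c p w) \<in> D \<and> F p (tvec_of M c p w) < 1} = q.K"
    by (auto simp: q.K_def domain_iff[OF c] metric_chart[OF c])
  ultimately show ?thesis
    by (simp add: distortion_def distortion_in_chart_def volume_ratio_def q.\<tau>_def flip: c_def)
qed

lemma distortion_attains_min:
  assumes "(p, y) \<in> D"
  obtains y0 where "(p, y0) \<in> D" "\<And>y. (p, y) \<in> D \<Longrightarrow> distortion M D F p y0 \<le> distortion M D F p y"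
proof -
  define c where "c = some_chart M p"
  have p: "p \<in> topspace (mtop M)"
    using assms by (auto simp: infinite_series_domain_def slit_tangent_bundle_def)
  have c: "c \<in> charts_at M p" unfolding c_def by (rule some_chart[OF p])
  interpret q: quadratic_linear "chart_metric M a c p" "chart_form M \<beta> c p"
    by (rule quadratic_linear_chart[OF c])
  have mem: "y c \<in> q.\<Omega>" if "(p, y) \<in> D" for y
  proof -
    have "y \<in> tangent_space M p" using that by (auto simp: infinite_series_domain_def slit_tangent_bundle_def)
    then show ?thesis using that domain_iff[OF c, of "y c"] tvec_of_eq[OF c] by simp
  qed
  then have "q.\<Omega> \<noteq> {}" using assms by blast
  then obtain w where w: "w \<in> q.\<Omega>" "\<And>v. v \<in> q.\<Omega> \<Longrightarrow> q.\<tau> w \<le> q.\<tau> v"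
    using q.\<tau>_attains_min by blast
  have D: "(p, tvec_of M c p w) \<in> D" using w(1) domain_iff[OF c] by simp
  show thesis
  proof (rule that[OF D])
    fix y assume y: "(p, y) \<in> D"
    show "distortion M D F p (tvec_of M c p w) \<le> distortion M D F p y"
      unfolding distortion_chart[OF D] distortion_chart[OF y] c_def[symmetric] tvec_of_self[OF c]
      by (rule w(2)[OF mem[OF y]])
  qed
qed

end

locale homogeneous_infinite_series = homogeneous G L H M + infinite_series M a \<beta>
  for G :: "('g, 'x) monoid_scheme" and L :: "('g, 'f::euclidean_space) mfd"
    and H :: "'g set" and M :: "('g set, real^'n) mfd"
    and a :: "'g set \<Rightarrow> ('g set, real^'n) tvec \<Rightarrow> ('g set, real^'n) tvec \<Rightarrow> real"
    and \<beta> :: "'g set \<Rightarrow> ('g set, real^'n) tvec \<Rightarrow> real" +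
  assumes inv: "group_invariant G M (infinite_series_domain M a \<beta>) (infinite_series_metric a \<beta>)"
begin

lemma D_translation_domain:
  assumes g: "g \<in> carrier G" and p: "p \<in> topspace (mtop M)"
    and q: "g <#\<^bsub>G\<^esub> p \<in> topspace (mtop M)"
    and w: "w \<in> \<Omega> (some_chart M p) p"
  defines "T \<equiv> D_translation g (some_chart M p) (some_chart M (g <#\<^bsub>G\<^esub> p)) p"
  shows "T w \<in> \<Omega> (some_chart M (g <#\<^bsub>G\<^esub> p)) (g <#\<^bsub>G\<^esub> p)"
    and "F (g <#\<^bsub>G\<^esub> p) (tvec_of M (some_chart M (g <#\<^bsub>G\<^esub> p)) (g <#\<^bsub>G\<^esub> p) (T w))
      = F p (tvec_of M (some_chart M p) p w)"
proof -
  define c where "c = some_chart M p"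
  define c' where "c' = some_chart M (g <#\<^bsub>G\<^esub> p)"
  have c: "c \<in> charts_at M p" unfolding c_def by (rule M.some_chart[OF p])
  have c': "c' \<in> charts_at M (g <#\<^bsub>G\<^esub> p)" unfolding c'_def by (rule M.some_chart[OF q])
  define y where "y = tvec_of M c p w"
  define z where "z = differential M M (\<lambda>p. g <#\<^bsub>G\<^esub> p) p y"
  have "(p, y) \<in> D" using w domain_iff[OF c] by (simp add: y_def c_def)
  then have z: "(g <#\<^bsub>G\<^esub> p, z) \<in> D" "F (g <#\<^bsub>G\<^esub> p) z = F p y"
    using inv g unfolding group_invariant_def z_def by blast+
  have "z c' = D_translation g c c' p (y c)"
    unfolding z_def by (rule differential_translation[OF c_def c'])
  also have "\<dots> = T w" unfolding y_def M.tvec_of_self[OF c] by (simp add: T_def c_def c'_def)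
  finally have "z c' = T w" .
  \<comment> \<open>Being in D includes being a tangent vector, so z is determined by its component
    in c', which is \<open>T w\<close>.\<close>
  moreover have "z \<in> tangent_space M (g <#\<^bsub>G\<^esub> p)"
    using z(1) by (auto simp: infinite_series_domain_def slit_tangent_bundle_def)
  ultimately have "tvec_of M c' (g <#\<^bsub>G\<^esub> p) (T w) = z" using M.tvec_of_eq[OF c'] by metis
  then show "T w \<in> \<Omega> (some_chart M (g <#\<^bsub>G\<^esub> p)) (g <#\<^bsub>G\<^esub> p)"
    "F (g <#\<^bsub>G\<^esub> p) (tvec_of M (some_chart M (g <#\<^bsub>G\<^esub> p)) (g <#\<^bsub>G\<^esub> p) (T w))
      = F p (tvec_of M (some_chart M p) p w)"
    using z domain_iff[OF c', of "T w"] unfolding c_def[symmetric] c'_def[symmetric] y_def by simp_all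
qed

text \<open>Every value of the distortion over p is also a value over its translate. This is the
  form in which a minimum over one point bounds the values over all others.\<close>

lemma distortion_translation:
  assumes g: "g \<in> carrier G" and py: "(p, y) \<in> D"
  obtains z where "(g <#\<^bsub>G\<^esub> p, z) \<in> D" "distortion M D F (g <#\<^bsub>G\<^esub> p) z = distortion M D F p y"
proof
  define q where "q = g <#\<^bsub>G\<^esub> p"
  define c where "c = some_chart M p"
  define c' where "c' = some_chart M q"
  define z where "z = differential M M (\<lambda>p. g <#\<^bsub>G\<^esub> p) p y"
  have z: "(q, z) \<in> D" using inv g py unfolding group_invariant_def z_def q_def by blast
  show "(g <#\<^bsub>G\<^esub> p, z) \<in> D" using z by (simp add: q_def)
  have p: "p \<in> topspace (mtop M)" and yt: "y \<in> tangent_space M p" and q: "q \<in> topspace (mtop M)"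
    using py z by (auto simp: infinite_series_domain_def slit_tangent_bundle_def)
  have c: "c \<in> charts_at M p" unfolding c_def by (rule M.some_chart[OF p])
  have c': "c' \<in> charts_at M q" unfolding c'_def by (rule M.some_chart[OF q])
  have gp: "inv\<^bsub>G\<^esub> g <#\<^bsub>G\<^esub> q = p" unfolding q_def by (rule translate_inv[OF g p])
  have gq: "inv\<^bsub>G\<^esub> (inv\<^bsub>G\<^esub> g) <#\<^bsub>G\<^esub> p = q" using g by (simp add: q_def)
  have g': "inv\<^bsub>G\<^esub> g \<in> carrier G" using g by simp
  define T where "T = D_translation g c c' p"
  define T' where "T' = D_translation (inv\<^bsub>G\<^esub> g) c' c q"
  have T: "T w \<in> \<Omega> c' q" "F q (tvec_of M c' q (T w)) = F p (tvec_of M c p w)" if "w \<in> \<Omega> c p" for w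
    using D_translation_domain[OF g p, of w] q that unfolding T_def c_def c'_def q_def by simp_all
  have T': "T' w \<in> \<Omega> c p" if "w \<in> \<Omega> c' q" for w
    using D_translation_domain(1)[OF g' q, of w] p that unfolding T'_def c_def c'_def gp by simp
  \<comment> \<open>\<open>D_translation_inv\<close> for the inverse of g shows that T' is a right
    inverse of T. As T' maps cone into cone, T is onto between the cones.\<close>
  have "T (T' w) = w" for w
    using D_translation_inv[OF g' c', of c w] c g unfolding gp T_def T'_def by simp
  then have image: "T ` \<Omega> c p = \<Omega> c' q" using T(1) T' by (metis imageI image_subsetI subsetI subset_antisym)
  have lin: "linear T" unfolding T_def by (rule linear_D_translation[OF g c]) (use c' q_def in simp)
  have yc: "y c \<in> \<Omega> c p" using py domain_iff[OF c, of "y c"] M.tvec_of_eq[OF c yt] by simp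
  have "quadratic_linear.\<tau> (chart_metric M a c p) (chart_form M \<beta> c p) (y c)
      = quadratic_linear.\<tau> (chart_metric M a c' q) (chart_form M \<beta> c' q) (T (y c))"
    by (rule \<tau>_linear_invariant[OF quadratic_linear_chart[OF c] quadratic_linear_chart[OF c'] lin image])
      (use T(2) yc in \<open>simp_all add: metric_chart[OF c] metric_chart[OF c']\<close>)
  moreover have "z c' = T (y c)"
    unfolding z_def T_def by (rule differential_translation[OF c_def]) (use c' q_def in simp)
  ultimately show "distortion M D F (g <#\<^bsub>G\<^esub> p) z = distortion M D F p y"
    unfolding distortion_chart[OF py] q_def[symmetric] distortion_chart[OF z] c_def[symmetric] c'_def[symmetric]
    by simp
qed

lemma S_curvature_zero_at_min:
  assumes y0: "(p, y0) \<in> D" and min: "\<And>y. (p, y) \<in> D \<Longrightarrow> distortion M D F p y0 \<le> distortion M D F p y"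
    and S: "has_S_curvature M D F p y0 s"
  shows "s = 0"
proof -
  obtain I \<gamma> where I: "open I" "0 \<in> I" and \<gamma>: "geodesic_on M D F I \<gamma>" "\<gamma> 0 = p" "velocity M \<gamma> 0 = y0"
    and der: "((\<lambda>t. distortion M D F (\<gamma> t) (velocity M \<gamma> t)) has_real_derivative s) (at 0)"
    using S unfolding has_S_curvature_def by blast
  obtain e where e: "e > 0" "ball 0 e \<subseteq> I" using I openE by blast
  show ?thesis
  proof (rule DERIV_local_min[OF der e(1)], intro allI impI)
    fix t :: real assume "\<bar>0 - t\<bar> < e"
    then have "t \<in> I" using e(2) by (auto simp: dist_real_def)
    then have t: "(\<gamma> t, velocity M \<gamma> t) \<in> D" using \<gamma>(1) unfolding geodesic_on_def by blast
    have "\<gamma> t \<in> topspace (mtop M)" "p \<in> topspace (mtop M)"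
      using t y0 by (auto simp: infinite_series_domain_def slit_tangent_bundle_def)
    \<comment> \<open>Each position of the geodesic is moved back to p by its own group element. No
      dependence of g on t matters, since only values of the distortion are compared with the
      minimum over p.\<close>
    then obtain g where g: "g \<in> carrier G" "g <#\<^bsub>G\<^esub> \<gamma> t = p" by (rule transitive)
    from distortion_translation[OF g(1) t] obtain z where
      "(p, z) \<in> D" "distortion M D F p z = distortion M D F (\<gamma> t) (velocity M \<gamma> t)"
      unfolding g(2) by blast
    with min show "distortion M D F (\<gamma> 0) (velocity M \<gamma> 0) \<le> distortion M D F (\<gamma> t) (velocity M \<gamma> t)"
      unfolding \<gamma>(2,3) by metis
  qed
qed

lemma isotropic_imp_vanishing:
  assumes pos: "\<And>p y. (p, y) \<in> D \<Longrightarrow> F p y > 0" and iso: "isotropic_S_curvature M D F"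
  shows "vanishing_S_curvature M D F"
  unfolding vanishing_S_curvature_def
proof clarify
  obtain c where c: "\<And>p y. (p, y) \<in> D \<Longrightarrow> has_S_curvature M D F p y (real (CARD('n) + 1) * c p * F p y)"
    using iso unfolding isotropic_S_curvature_def by blast
  fix p y assume y: "(p, y) \<in> D"
  obtain y0 where y0: "(p, y0) \<in> D" "\<And>y. (p, y) \<in> D \<Longrightarrow> distortion M D F p y0 \<le> distortion M D F p y"
    using distortion_attains_min[OF y] by blast
  have "real (CARD('n) + 1) * c p * F p y0 = 0"
    by (rule S_curvature_zero_at_min[OF y0 c[OF y0(1)]])
  then have "c p = 0" using pos[OF y0(1)] by simp
  then show "has_S_curvature M D F p y 0" using c[OF y] by simp
qed

end

lemma smooth_on_const_zero: "smooth_on S (\<lambda>x. 0 :: 'b::real_normed_vector)"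
proof -
  have "Ck_on k S (\<lambda>x. 0 :: 'b)" for k
    by (induction k) (simp_all add: frechet_derivative_const)
  then show ?thesis by (simp add: smooth_on_def)
qed

lemma vanishing_imp_isotropic:
  assumes "vanishing_S_curvature M D F"
  shows "isotropic_S_curvature M D F"
  unfolding isotropic_S_curvature_def
proof (intro exI[of _ "\<lambda>p. 0"] conjI)
  show "smooth_function M (\<lambda>p. 0)" by (simp add: smooth_function_def o_def smooth_on_const_zero)
qed (use assms in \<open>simp add: vanishing_S_curvature_def\<close>)

theorem theorem4p4:
  fixes G :: "('g, 'x) monoid_scheme"
    and L :: "('g, 'f::euclidean_space) mfd"
    and H :: "'g set"
    and M :: "('g set, real^'n) mfd"
    and m :: "('g, 'f) tvec set"
    and a :: "'g set \<Rightarrow> ('g set, real^'n) tvec \<Rightarrow> ('g set, real^'n) tvec \<Rightarrow> real"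
    and \<beta> :: "'g set \<Rightarrow> ('g set, real^'n) tvec \<Rightarrow> real"
    and F :: "'g set \<Rightarrow> ('g set, real^'n) tvec \<Rightarrow> real"
    and D :: "('g set \<times> ('g set, real^'n) tvec) set"
  assumes "lie_group G L"
    and "subgroup H G" and "compactin (mtop L) H"
    and "homogeneous_space G L H M" and "connected_space (mtop M)"
    and "reductive_decomposition G L H m"
    and "riemannian_metric M a" and "one_form M \<beta>"
    and "F = infinite_series_metric a \<beta>" and "D = infinite_series_domain M a \<beta>"
    and "finsler_metric_on M D F"
    and "group_invariant G M D F"
  shows "isotropic_S_curvature M D F \<longleftrightarrow> vanishing_S_curvature M D F"
proof
  interpret h: homogeneous G L H M
    by (rule homogeneous.intro[OF lie.intro[OF assms(1)] homogeneous_axioms.intro[OF assms(2,4)]])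
  interpret homogeneous_infinite_series G L H M a \<beta>
    by (intro homogeneous_infinite_series.intro h.homogeneous_axioms infinite_series.intro
        h.M.manifold_axioms infinite_series_axioms.intro homogeneous_infinite_series_axioms.intro)
      (use assms in simp_all)
  have "F p y > 0" if "(p, y) \<in> D" for p y
    using \<open>finsler_metric_on M D F\<close> that unfolding finsler_metric_on_def by blast
  then show "vanishing_S_curvature M D F" if "isotropic_S_curvature M D F"
    using isotropic_imp_vanishing that unfolding assms(9,10) by blast
qed (rule vanishing_imp_isotropic)

end
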